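(* Let $M$ be a pointed complete metric space. If $\mathrm{Lip}_0(M)$ has the Daugavet property, then it has the polynomial Daugavet property.
   Context: A pointed metric space is a metric space $M$ with a distinguished point $0\in M$. $\mathrm{Lip}_0(M)$ is the real Banach space of Lipschitz functions $f\colon M\to\mathbb{R}$ with $f(0)=0$, normed by the Lipschitz constant $\|f\|_L=\sup\{|f(x)-f(y)|/d(x,y)\colon x,y\in M,\ x\neq y\}$. A Banach space $X$ has the Daugavet property if $\|\mathrm{Id}+T\|=1+\|T\|$ for every rank-one bounded linear operator $T\colon X\to X$. A continuous polynomial $P\colon X\to X$ is a finite sum $\sum_{k=0}^nP_k$ of continuous $k$-homogeneous polynomials (constant for $k=0$), with norm $\|P\|=\sup_{x\in B_X}\|P(x)\|$; it is weakly compact if $P(B_X)$ is relatively weakly compact. $X$ has the polynomial Daugavet property if $\|\mathrm{Id}+P\|=1+\|P\|$ for every weakly compact continuous polynomial $P\colon X\to X$. *)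

theory Defs
  imports "HOL-Analysis.Analysis"
begin

section \<open>The space of Lipschitz functions vanishing at the distinguished point\<close>

text \<open>
  A pointed metric space is a type of sort \<open>{metric_space, zero}\<close>. The class \<open>zero\<close> carries no
  axioms, so the constant \<open>0\<close> is just an arbitrary distinguished point.
\<close>

typedef (overloaded) 'm lip0 =
  "{f :: 'm::{metric_space,zero} \<Rightarrow> real. f 0 = 0 \<and> (\<exists>C. C-lipschitz_on UNIV f)}"
  morphisms lip0_apply Lip0
  by (rule exI[of _ "\<lambda>_. 0"]) (auto intro!: exI[of _ 0] lipschitz_onI)

setup_lifting type_definition_lip0

text \<open>
  The pairs \<open>(x, x)\<close> contribute the value \<open>0 / 0 = 0\<close>. So this is the supremum of the quotients over
  distinct points, and it is \<open>0\<close> if there are no distinct points.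
\<close>

definition lipschitz_const :: "('m::metric_space \<Rightarrow> real) \<Rightarrow> real" where
  "lipschitz_const f = (SUP (x, y). \<bar>f x - f y\<bar> / dist x y)"

lemma lipschitz_quotient_le:
  assumes "C-lipschitz_on UNIV (f :: 'm::metric_space \<Rightarrow> real)"
  shows "\<bar>f x - f y\<bar> / dist x y \<le> C"
proof (cases "x = y")
  case False
  then show ?thesis
    using lipschitz_onD[OF assms, of x y] by (simp add: divide_le_eq dist_real_def)
qed (use lipschitz_on_nonneg[OF assms] in simp)

lemma bdd_above_lipschitz_quotients:
  assumes "C-lipschitz_on UNIV (f :: 'm::metric_space \<Rightarrow> real)"
  shows "bdd_above (range (\<lambda>(x, y). \<bar>f x - f y\<bar> / dist x y))"
  using lipschitz_quotient_le[OF assms] by (intro bdd_aboveI[of _ C]) auto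

lemma lipschitz_const_le:
  assumes "C-lipschitz_on UNIV (f :: 'm::metric_space \<Rightarrow> real)"
  shows "lipschitz_const f \<le> C"
  unfolding lipschitz_const_def
  using lipschitz_quotient_le[OF assms] by (intro cSUP_least) auto

lemma lipschitz_const_lipschitz_on:
  assumes "C-lipschitz_on UNIV (f :: 'm::metric_space \<Rightarrow> real)"
  shows "(lipschitz_const f)-lipschitz_on UNIV f"
proof (rule lipschitz_onI)
  have le: "\<bar>f x - f y\<bar> / dist x y \<le> lipschitz_const f" for x y
    using cSUP_upper[OF UNIV_I bdd_above_lipschitz_quotients[OF assms], of "(x, y)"]
    by (simp add: lipschitz_const_def)
  show "0 \<le> lipschitz_const f"
    using le[of undefined undefined] by simp
  show "dist (f x) (f y) \<le> lipschitz_const f * dist x y" for x y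
    using le[of x y] by (cases "x = y") (auto simp: dist_real_def divide_le_eq)
qed

instantiation lip0 :: ("{metric_space,zero}") real_vector
begin

lift_definition zero_lip0 :: "'a lip0" is "\<lambda>_. 0"
  by (auto intro!: exI[of _ 0] lipschitz_onI)

lift_definition plus_lip0 :: "'a lip0 \<Rightarrow> 'a lip0 \<Rightarrow> 'a lip0" is "\<lambda>f g x. f x + g x"
  by (auto intro: lipschitz_on_add)

lift_definition uminus_lip0 :: "'a lip0 \<Rightarrow> 'a lip0" is "\<lambda>f x. - f x"
  by (auto intro: lipschitz_on_minus)

lift_definition minus_lip0 :: "'a lip0 \<Rightarrow> 'a lip0 \<Rightarrow> 'a lip0" is "\<lambda>f g x. f x - g x"
  by (auto intro: lipschitz_on_diff)

lift_definition scaleR_lip0 :: "real \<Rightarrow> 'a lip0 \<Rightarrow> 'a lip0" is "\<lambda>r f x. r * f x"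
  by (auto intro: lipschitz_on_cmult_real)

instance
  by standard (transfer; auto simp: algebra_simps)+

end

instantiation lip0 :: ("{metric_space,zero}") real_normed_vector
begin

lift_definition norm_lip0 :: "'a lip0 \<Rightarrow> real" is lipschitz_const .

definition dist_lip0 :: "'a lip0 \<Rightarrow> 'a lip0 \<Rightarrow> real" where
  "dist_lip0 f g = norm (f - g)"

definition uniformity_lip0 :: "('a lip0 \<times> 'a lip0) filter" where
  [code del]: "uniformity_lip0 = (INF e\<in>{0<..}. principal {(x, y). dist x y < e})"

definition open_lip0 :: "'a lip0 set \<Rightarrow> bool" where
  [code del]: "open_lip0 S = (\<forall>x\<in>S. \<forall>\<^sub>F (x', y) in uniformity. x' = x \<longrightarrow> y \<in> S)"

definition sgn_lip0 :: "'a lip0 \<Rightarrow> 'a lip0" where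
  "sgn_lip0 f = inverse (norm f) *\<^sub>R f"

instance
proof
  fix f g :: "'a lip0" and r :: real
  show "norm f = 0 \<longleftrightarrow> f = 0"
  proof transfer
    fix f :: "'a \<Rightarrow> real"
    assume f: "f 0 = 0 \<and> (\<exists>C. C-lipschitz_on UNIV f)"
    then have L: "(lipschitz_const f)-lipschitz_on UNIV f"
      using lipschitz_const_lipschitz_on by blast
    show "lipschitz_const f = 0 \<longleftrightarrow> f = (\<lambda>_. 0)"
    proof
      assume "lipschitz_const f = 0"
      then have "dist (f x) (f 0) \<le> 0" for x
        using lipschitz_onD[OF L, of x 0] by simp
      then show "f = (\<lambda>_. 0)" using f by auto
    qed (simp add: lipschitz_const_def)
  qed
  show "norm (f + g) \<le> norm f + norm g"
    by transfer (blast intro: lipschitz_const_le lipschitz_on_add lipschitz_const_lipschitz_on)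
  have le: "norm (s *\<^sub>R h) \<le> \<bar>s\<bar> * norm h" for s and h :: "'a lip0"
    by transfer (blast intro: lipschitz_const_le lipschitz_on_cmult_real lipschitz_const_lipschitz_on)
  show "norm (r *\<^sub>R f) = \<bar>r\<bar> * norm f"
  proof (cases "r = 0")
    case True
    have "0 \<le> norm (0 *\<^sub>R f)"
      by transfer (auto simp: lipschitz_const_def)
    then show ?thesis using True le[of r f] by simp
  next
    case False
    have "norm f = norm (inverse r *\<^sub>R (r *\<^sub>R f))"
      using False by simp
    also have "\<dots> \<le> \<bar>inverse r\<bar> * norm (r *\<^sub>R f)"
      by (rule le)
    finally have "\<bar>r\<bar> * norm f \<le> norm (r *\<^sub>R f)"
      using False by (simp add: field_simps)
    with le[of r f] show ?thesis by simp
  qed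
qed (rule dist_lip0_def uniformity_lip0_def open_lip0_def sgn_lip0_def)+

end

lemma lip0_apply_lipschitz_on: "(norm f)-lipschitz_on UNIV (lip0_apply f)"
  by transfer (blast intro: lipschitz_const_lipschitz_on)

lemma lip0_apply_zero [simp]: "lip0_apply f 0 = 0"
  by transfer simp

instance lip0 :: ("{metric_space,zero}") banach
proof
  fix X :: "nat \<Rightarrow> 'a lip0"
  assume X: "Cauchy X"
  have diff: "dist (lip0_apply f x - lip0_apply g x) (lip0_apply f y - lip0_apply g y)
      \<le> norm (f - g) * dist x y" for f g :: "'a lip0" and x y
    using lipschitz_onD[OF lip0_apply_lipschitz_on[of "f - g"], of x y]
    by (simp add: minus_lip0.rep_eq)
  have "Cauchy (\<lambda>n. lip0_apply (X n) x)" for x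
  proof (rule CauchyI)
    fix e :: real assume e: "0 < e"
    define d where "d = e / (1 + dist x 0)"
    have pos: "0 < 1 + dist x 0"
      using zero_le_dist[of x 0] by linarith
    have d: "0 < d" using e pos by (simp add: d_def)
    then obtain N where N: "\<And>m n. m \<ge> N \<Longrightarrow> n \<ge> N \<Longrightarrow> norm (X m - X n) < d"
      using X CauchyD by blast
    have "norm (lip0_apply (X m) x - lip0_apply (X n) x) < e" if "m \<ge> N" "n \<ge> N" for m n
    proof -
      have "norm (lip0_apply (X m) x - lip0_apply (X n) x) \<le> norm (X m - X n) * dist x 0"
        using diff[of "X m" x "X n" 0] by simp
      also have "\<dots> \<le> d * dist x 0"
        using N[OF that] by (intro mult_right_mono) auto
      also have "\<dots> < d * (1 + dist x 0)"
        using d by (intro mult_strict_left_mono) auto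
      also have "\<dots> = e" using pos by (simp add: d_def)
      finally show ?thesis .
    qed
    then show "\<exists>M. \<forall>m\<ge>M. \<forall>n\<ge>M. norm (lip0_apply (X m) x - lip0_apply (X n) x) < e"
      by blast
  qed
  then have "\<forall>x. \<exists>l. (\<lambda>n. lip0_apply (X n) x) \<longlonglongrightarrow> l"
    using Cauchy_convergent convergent_def by blast
  then obtain f where f: "\<And>x. (\<lambda>n. lip0_apply (X n) x) \<longlonglongrightarrow> f x"
    by metis
  have lim: "e-lipschitz_on UNIV (\<lambda>x. lip0_apply (X m) x - f x)"
    if e: "0 < e" and N: "\<And>n. n \<ge> N \<Longrightarrow> norm (X m - X n) < e" for e m N
  proof (rule lipschitz_onI)
    fix x y
    have "(\<lambda>n. dist (lip0_apply (X m) x - lip0_apply (X n) x) (lip0_apply (X m) y - lip0_apply (X n) y))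
        \<longlonglongrightarrow> dist (lip0_apply (X m) x - f x) (lip0_apply (X m) y - f y)"
      by (intro tendsto_intros f)
    moreover have "dist (lip0_apply (X m) x - lip0_apply (X n) x) (lip0_apply (X m) y - lip0_apply (X n) y)
        \<le> e * dist x y" if "n \<ge> N" for n
      using diff[of "X m" x "X n" y] mult_right_mono[of "norm (X m - X n)" e "dist x y"] N[OF that]
      by simp
    ultimately show "dist (lip0_apply (X m) x - f x) (lip0_apply (X m) y - f y) \<le> e * dist x y"
      by (intro LIMSEQ_le_const2) auto
  qed (use e in simp)
  have f0: "f 0 = 0"
    using LIMSEQ_unique[OF f[of 0]] by simp
  have "\<exists>C. C-lipschitz_on UNIV f"
  proof -
    obtain N where N: "\<And>m n. m \<ge> N \<Longrightarrow> n \<ge> N \<Longrightarrow> norm (X m - X n) < 1"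
      using X CauchyD zero_less_one by blast
    from lipschitz_on_diff[OF lip0_apply_lipschitz_on[of "X N"] lim[OF zero_less_one N[OF order_refl]]]
    show ?thesis by auto
  qed
  with f0 have apply_F: "lip0_apply (Lip0 f) = f"
    by (simp add: Lip0_inverse)
  have "X \<longlonglongrightarrow> Lip0 f"
  proof (rule LIMSEQ_I)
    fix e :: real assume e: "0 < e"
    then have "0 < e / 2" by simp
    then obtain N where N: "\<And>m n. m \<ge> N \<Longrightarrow> n \<ge> N \<Longrightarrow> norm (X m - X n) < e / 2"
      using X CauchyD by blast
    have "norm (X m - Lip0 f) < e" if "m \<ge> N" for m
    proof -
      have "(e / 2)-lipschitz_on UNIV (\<lambda>x. lip0_apply (X m) x - f x)"
        using \<open>0 < e / 2\<close> N[OF that] by (rule lim)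
      then have "norm (X m - Lip0 f) \<le> e / 2"
        unfolding norm_lip0.rep_eq minus_lip0.rep_eq apply_F by (rule lipschitz_const_le)
      with e show ?thesis by simp
    qed
    then show "\<exists>N. \<forall>n\<ge>N. norm (X n - Lip0 f) < e"
      by blast
  qed
  then show "convergent X"
    by (auto simp: convergent_def)
qed


section \<open>The Daugavet property\<close>

text \<open>
  The zero operator counts as an operator of the form \<open>\<phi>(\<cdot>) y\<close>. On a nontrivial space it satisfies
  the Daugavet equation anyway. Its only effect is that the space \<open>{0}\<close>, where
  \<open>\<parallel>Id + 0\<parallel> = 0 < 1 + \<parallel>0\<parallel>\<close>, does not have the Daugavet property. With the other
  convention \<open>{0}\<close> would have it vacuously, but would never have the polynomial one.
\<close>

definition rank_one :: "('x::real_normed_vector \<Rightarrow>\<^sub>L 'y::real_normed_vector) \<Rightarrow> bool" where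
  "rank_one T \<longleftrightarrow> (\<exists>(\<phi> :: 'x \<Rightarrow>\<^sub>L real) y. \<forall>x. blinfun_apply T x = blinfun_apply \<phi> x *\<^sub>R y)"

definition daugavet_property :: "'x::banach itself \<Rightarrow> bool" where
  "daugavet_property _ \<longleftrightarrow>
     (\<forall>T :: 'x \<Rightarrow>\<^sub>L 'x. rank_one T \<longrightarrow> norm (id_blinfun + T) = 1 + norm T)"


section \<open>Polynomials and the polynomial Daugavet property\<close>

text \<open>
  A \<open>k\<close>-linear map on \<open>X\<^sup>k\<close> is encoded as a map on sequences that only depends on the entries with
  index below \<open>k\<close>. For such maps, continuity in the product topology on sequences is continuity in
  the product topology on \<open>X\<^sup>k\<close>.
\<close>

definition continuous_multilinear ::
  "nat \<Rightarrow> ((nat \<Rightarrow> 'x::real_normed_vector) \<Rightarrow> 'y::real_normed_vector) \<Rightarrow> bool" where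
  "continuous_multilinear k A \<longleftrightarrow>
     (\<forall>x y. (\<forall>i<k. x i = y i) \<longrightarrow> A x = A y) \<and>
     (\<forall>x. \<forall>i<k. linear (\<lambda>v. A (x(i := v)))) \<and>
     continuous_on UNIV A"

definition continuous_homogeneous_polynomial ::
  "nat \<Rightarrow> ('x::real_normed_vector \<Rightarrow> 'y::real_normed_vector) \<Rightarrow> bool" where
  "continuous_homogeneous_polynomial k P \<longleftrightarrow>
     (\<exists>A. continuous_multilinear k A \<and> (\<forall>x. P x = A (\<lambda>_. x)))"

definition continuous_polynomial ::
  "('x::real_normed_vector \<Rightarrow> 'y::real_normed_vector) \<Rightarrow> bool" where
  "continuous_polynomial P \<longleftrightarrow>
     (\<exists>n Q. (\<forall>k\<le>n. continuous_homogeneous_polynomial k (Q k)) \<and> (\<forall>x. P x = (\<Sum>k\<le>n. Q k x)))"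

definition polynomial_norm ::
  "('x::real_normed_vector \<Rightarrow> 'y::real_normed_vector) \<Rightarrow> real" where
  "polynomial_norm P = (SUP x\<in>cball 0 1. norm (P x))"

definition weak_topology :: "'x::real_normed_vector topology" where
  "weak_topology =
     topology_generated_by {blinfun_apply \<phi> -` U | (\<phi> :: 'x \<Rightarrow>\<^sub>L real) U. open U}"

definition relatively_weakly_compact :: "'x::real_normed_vector set \<Rightarrow> bool" where
  "relatively_weakly_compact S \<longleftrightarrow> compactin weak_topology (weak_topology closure_of S)"

definition weakly_compact_map ::
  "('x::real_normed_vector \<Rightarrow> 'y::real_normed_vector) \<Rightarrow> bool" where
  "weakly_compact_map P \<longleftrightarrow> relatively_weakly_compact (P ` cball 0 1)"

definition polynomial_daugavet_property :: "'x::banach itself \<Rightarrow> bool" where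
  "polynomial_daugavet_property _ \<longleftrightarrow>
     (\<forall>P :: 'x \<Rightarrow> 'x. continuous_polynomial P \<longrightarrow> weakly_compact_map P \<longrightarrow>
        polynomial_norm (\<lambda>x. x + P x) = 1 + polynomial_norm P)"

end

theory Submission
  imports Defs
begin

text \<open>
  Let \<open>P\<close> be a weakly compact continuous polynomial on \<open>Lip\<^sub>0(M)\<close>. Only
  \<open>\<parallel>Id + P\<parallel> \<ge> 1 + \<parallel>P\<parallel>\<close> needs proof. Choose \<open>f\<close> with \<open>\<parallel>f\<parallel> < 1\<close> and \<open>\<parallel>P f\<parallel>\<close> close to \<open>\<parallel>P\<parallel>\<close>. It is
  enough to find \<open>g\<close> in the unit ball and points \<open>u \<noteq> v\<close> between which \<open>g\<close> has slope \<open>1\<close> and \<open>P g\<close> has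
  slope almost \<open>\<parallel>P f\<parallel>\<close>. Such a \<open>g\<close> is \<open>f\<close> plus finitely many small bumps, and two ideas give it.

  The first is geometric. Suppose that \<open>w\<close> has norm \<open>1\<close> and slope almost \<open>1\<close> between \<open>a\<close> and \<open>b\<close>. Add
  to \<open>w\<close> a function that is steep only along almost geodesic paths from \<open>a\<close> to \<open>b\<close>. The Daugavet
  property, applied to the functional "slope from \<open>b\<close> to \<open>a\<close>" and to the direction of this sum,
  yields a pair at most half as far apart with the same quality (\<open>daugavet_halve_pair\<close>). Iteration
  gives arbitrarily short pairs. They also exist away from given points: one first flattens \<open>w\<close> near these points, which
  hardly changes the slope between the fixed points \<open>a\<close> and \<open>b\<close> and never makes an increment
  larger. So there is a sequence of pairs, as short as desired in comparison to their mutual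
  distances, between which \<open>w\<close> is almost as steep as possible (\<open>daugavet_separated_pairs\<close>). Since
  \<open>\<parallel>f\<parallel> < 1\<close>, one can add to \<open>f\<close> disjointly supported bumps \<open>h\<^sub>n\<close>, one at each pair, any finite
  number of which keeps \<open>f\<close> in the unit ball and raises the slope at the chosen pairs to \<open>1\<close>
  (\<open>add_bumps\<close>). This is used for the \<open>w\<close> with \<open>P f = \<parallel>P f\<parallel> w\<close>.

  The second is that such bumps can be added without destroying the steepness of \<open>P f\<close>
  (\<open>weakly_compact_polynomial_diagonal\<close>). The bumps behave like the unit vector basis of \<open>c\<^sub>0\<close>, so
  \<open>\<phi>(P(u + h\<^sub>n))\<close> tends to \<open>\<phi>(P u)\<close> for each fixed functional \<open>\<phi>\<close> (\<open>degree_le_tendsto\<close>). The slope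
  between the \<open>n\<close>-th pair is a functional that changes with \<open>n\<close>, and here weak compactness enters:
  Grothendieck's double limit argument, along the partial sums of a sparse subsequence of bumps,
  exchanges the limits in the functional and in the argument.
\<close>

section \<open>Polynomials and finite differences\<close>

text \<open>
  Frechet's description of polynomials: all differences of order \<open>d + 1\<close> vanish. It makes sense
  without homogeneous parts, passes to translates, and \<open>x \<mapsto> q(x + v) - q x\<close> has smaller degree. So
  inductions over the degree need no expansion of \<open>P(u + h)\<close>.
\<close>

primrec degree_le :: "nat \<Rightarrow> ('a::ab_group_add \<Rightarrow> 'b::ab_group_add) \<Rightarrow> bool" where
  "degree_le 0 q \<longleftrightarrow> (\<forall>x y. q x = q y)"
| "degree_le (Suc d) q \<longleftrightarrow> (\<forall>v. degree_le d (\<lambda>x. q (x + v) - q x))"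

lemma degree_le_Suc: "degree_le d q \<Longrightarrow> degree_le (Suc d) q"
proof (induction d arbitrary: q)
  case 0
  then have "q (x + v) - q x = q (y + v) - q y" for x y v
    by (metis degree_le.simps(1))
  then show ?case by simp
next
  case (Suc d)
  then have "degree_le (Suc d) (\<lambda>x. q (x + v) - q x)" for v
    by (intro Suc.IH) simp
  then show ?case
    by (subst degree_le.simps(2)) blast
qed

lemma degree_le_mono:
  assumes "d \<le> e" "degree_le d q"
  shows "degree_le e q"
  using assms by (induction rule: dec_induct) (auto dest: degree_le_Suc simp del: degree_le.simps(2))

lemma degree_le_const: "degree_le d (\<lambda>_. c)"
  by (rule degree_le_mono[of 0]) auto

lemma degree_le_add: "degree_le d p \<Longrightarrow> degree_le d q \<Longrightarrow> degree_le d (\<lambda>x. p x + q x)"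
proof (induction d arbitrary: p q)
  case 0
  then show ?case by simp metis
next
  case (Suc d)
  have "degree_le d (\<lambda>x. (p (x + v) - p x) + (q (x + v) - q x))" for v
    using Suc.prems by (intro Suc.IH) auto
  then show ?case by (simp add: algebra_simps)
qed

lemma degree_le_sum:
  assumes "finite I" "\<And>i. i \<in> I \<Longrightarrow> degree_le d (q i)"
  shows "degree_le d (\<lambda>x. \<Sum>i\<in>I. q i x)"
  using assms by (induction I) (auto intro: degree_le_add degree_le_const)

lemma degree_le_linear_comp:
  assumes diff: "\<And>a b. l (a - b) = l a - l b"
    and "degree_le d q"
  shows "degree_le d (\<lambda>x. l (q x))"
  using assms(2)
proof (induction d arbitrary: q)
  case 0
  then show ?case by simp metis
next
  case (Suc d)
  then show ?case by (simp add: diff[symmetric])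
qed

text \<open>
  The difference of the restriction of a multilinear map to a (translated) diagonal splits, by
  exchanging the arguments one after another, into maps of the same kind with one argument fixed at
  \<open>v\<close>. The fixed arguments and the different translations of the arguments that occur are the reason
  for the general form with the set \<open>I\<close> and the vectors \<open>c i\<close>.
\<close>

lemma degree_le_diagonal:
  fixes A :: "('i \<Rightarrow> 'x::ab_group_add) \<Rightarrow> 'y::ab_group_add"
  assumes "finite I"
    and additive: "\<And>x i u v. i \<in> I \<Longrightarrow> A (x(i := u + v)) = A (x(i := u)) + A (x(i := v))"
  shows "degree_le (card I) (\<lambda>x. A (\<lambda>i. if i \<in> I then x + c i else c i))"
  using assms
proof (induction "card I" arbitrary: I c)
  case 0
  then show ?case by simp
next
  case (Suc d)
  \<comment> \<open>The arguments in \<open>J\<close> are already exchanged for those belonging to \<open>x + v\<close>.\<close>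
  define p where "p J x v = A (\<lambda>i. if i \<in> I then x + (if i \<in> J then v + c i else c i) else c i)" for J x v
  have step: "degree_le d (\<lambda>x. p J x v - p {} x v)" if "J \<subseteq> I" "finite J" for J v
    using that(2,1)
  proof (induction J)
    case empty
    then show ?case by (simp add: degree_le_const)
  next
    case (insert j J)
    define c' where "c' i = (if i = j then v else if i \<in> J then v + c i else c i)" for i
    define y where "y x i = (if i \<in> I then x + (if i \<in> J then v + c i else c i) else c i)" for x i
    have I: "finite I" "j \<in> I" "Suc d = card I" "card (I - {j}) = d"
      using insert.prems Suc.prems Suc.hyps(2) by auto
    have "degree_le (card (I - {j})) (\<lambda>x. A (\<lambda>i. if i \<in> I - {j} then x + c' i else c' i))"
      using Suc.prems I by (intro Suc.hyps(1)) auto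
    moreover have "(\<lambda>i. if i \<in> I - {j} then x + c' i else c' i) = (y x)(j := v)" for x
      using insert.hyps insert.prems by (auto simp: c'_def y_def fun_eq_iff)
    ultimately have "degree_le d (\<lambda>x. A ((y x)(j := v)))"
      using I by simp
    moreover have "p (insert j J) x v - p J x v = A ((y x)(j := v))" for x
    proof -
      have "p (insert j J) x v = A ((y x)(j := v + (x + c j)))"
        unfolding p_def y_def using insert.hyps I
        by (intro arg_cong[of _ _ A]) (auto simp: fun_eq_iff algebra_simps)
      moreover have "p J x v = A ((y x)(j := x + c j))"
        unfolding p_def y_def using insert.hyps I
        by (intro arg_cong[of _ _ A]) (auto simp: fun_eq_iff algebra_simps)
      ultimately show ?thesis
        using Suc.prems(2)[OF I(2), of "y x" v "x + c j"] by simp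
    qed
    ultimately have "degree_le d (\<lambda>x. (p (insert j J) x v - p J x v) + (p J x v - p {} x v))"
      using insert by (intro degree_le_add) auto
    then show ?case by simp
  qed
  have "p I x v = A (\<lambda>i. if i \<in> I then (x + v) + c i else c i)"
    "p {} x v = A (\<lambda>i. if i \<in> I then x + c i else c i)" for x v
    unfolding p_def by (auto intro!: arg_cong[of _ _ A] simp: fun_eq_iff algebra_simps)
  then have "degree_le (Suc d) (\<lambda>x. A (\<lambda>i. if i \<in> I then x + c i else c i))"
    using step[OF order_refl] Suc.prems by simp
  then show ?case using Suc.hyps(2) by simp
qed

lemma continuous_homogeneous_polynomial_degree_le:
  assumes "continuous_homogeneous_polynomial k P"
  shows "degree_le k P"
proof -
  obtain A where A: "continuous_multilinear k A" "\<And>x. P x = A (\<lambda>_. x)"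
    using assms by (auto simp: continuous_homogeneous_polynomial_def)
  have "degree_le (card {..<k}) (\<lambda>x. A (\<lambda>i. if i \<in> {..<k} then x + 0 else 0))"
  proof (rule degree_le_diagonal)
    fix x i u v assume "i \<in> {..<k}"
    then have "linear (\<lambda>v. A (x(i := v)))"
      using A(1) unfolding continuous_multilinear_def by blast
    from linear_add[OF this] show "A (x(i := u + v)) = A (x(i := u)) + A (x(i := v))" .
  qed simp
  moreover have "A (\<lambda>i. if i \<in> {..<k} then x + 0 else 0) = P x" for x
    using A unfolding continuous_multilinear_def by auto
  ultimately show ?thesis by simp
qed

lemma continuous_homogeneous_polynomial_scaleR:
  assumes "continuous_homogeneous_polynomial k P"
  shows "P (r *\<^sub>R x) = r ^ k *\<^sub>R P x"
proof -
  obtain A where A: "continuous_multilinear k A" "\<And>x. P x = A (\<lambda>_. x)"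
    using assms by (auto simp: continuous_homogeneous_polynomial_def)
  have "A (\<lambda>i. if i < j then r *\<^sub>R x else x) = r ^ j *\<^sub>R A (\<lambda>_. x)" if "j \<le> k" for j
    using that
  proof (induction j)
    case (Suc j)
    define y where "y = (\<lambda>i. if i < j then r *\<^sub>R x else x)"
    have "linear (\<lambda>v. A (y(j := v)))"
      using A(1) Suc.prems unfolding continuous_multilinear_def by auto
    from linear_scale[OF this, of r x]
    have "A (y(j := r *\<^sub>R x)) = r *\<^sub>R A (y(j := x))" .
    moreover have "y(j := x) = y" "y(j := r *\<^sub>R x) = (\<lambda>i. if i < Suc j then r *\<^sub>R x else x)"
      by (auto simp: y_def fun_eq_iff)
    ultimately show ?case using Suc y_def by simp
  qed simp
  from this[of k] have "A (\<lambda>i. if i < k then r *\<^sub>R x else x) = r ^ k *\<^sub>R A (\<lambda>_. x)" by simp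
  moreover have "A (\<lambda>i. if i < k then r *\<^sub>R x else x) = A (\<lambda>_. r *\<^sub>R x)"
    using A(1) unfolding continuous_multilinear_def by auto
  ultimately show ?thesis using A(2) by simp
qed

lemma continuous_homogeneous_polynomial_continuous:
  assumes "continuous_homogeneous_polynomial k P"
  shows "continuous_on UNIV P"
proof -
  obtain A where A: "continuous_multilinear k A" "\<And>x. P x = A (\<lambda>_. x)"
    using assms by (auto simp: continuous_homogeneous_polynomial_def)
  have cont: "continuous_on UNIV A"
    using A(1) by (simp add: continuous_multilinear_def)
  have "continuous_on UNIV (\<lambda>x. (\<lambda>_. x) :: nat \<Rightarrow> 'a)"
    by (intro continuous_on_coordinatewise_then_product continuous_intros)
  from continuous_on_compose2[OF cont this] show ?thesis by (simp add: A(2))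
qed

lemma continuous_homogeneous_polynomial_bound:
  assumes "continuous_homogeneous_polynomial k P"
  obtains C where "\<And>x. norm (P x) \<le> C * norm x ^ k"
proof -
  \<comment> \<open>A bound near \<open>0\<close>, where \<open>P\<close> is continuous, extends to all vectors by homogeneity.\<close>
  have "isCont P 0"
    using continuous_homogeneous_polynomial_continuous[OF assms]
    by (simp add: continuous_on_eq_continuous_at)
  then obtain s where s: "s > 0" "\<And>x. norm x < s \<Longrightarrow> dist (P x) (P 0) < 1"
    unfolding continuous_at_eps_delta by (metis dist_0_norm dist_commute zero_less_one)
  define B where "B = 1 + norm (P 0)"
  have B: "norm (P x) \<le> B" if "norm x < s" for x
    using s(2)[OF that] norm_triangle_sub[of "P x" "P 0"] by (simp add: B_def dist_norm)
  have "norm (P x) \<le> B * (2 / s) ^ k * norm x ^ k" for x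
  proof (cases "x = 0")
    case True
    then have "P x = 0 ^ k *\<^sub>R P x"
      using continuous_homogeneous_polynomial_scaleR[OF assms, of 0 x] by simp
    then show ?thesis
      using True B[of 0] s(1) by (cases "k = 0") (auto simp: power_0_left)
  next
    case False
    define r where "r = s / (2 * norm x)"
    have r: "r > 0" "norm (r *\<^sub>R x) < s"
      using False s(1) by (auto simp: r_def)
    have "r ^ k * norm (P x) \<le> B"
      using B[OF r(2)] r(1) continuous_homogeneous_polynomial_scaleR[OF assms, of r x] by simp
    then have "norm (P x) \<le> B * (1 / r) ^ k"
      using r(1) by (simp add: field_simps)
    also have "1 / r = 2 / s * norm x"
      by (simp add: r_def)
    finally show ?thesis
      by (simp only: power_mult_distrib mult.assoc)
  qed
  then show ?thesis by (rule that)
qed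

lemma continuous_polynomial_degree_le:
  assumes "continuous_polynomial P"
  obtains d where "degree_le d P"
proof -
  obtain n Q where Q: "\<And>k. k \<le> n \<Longrightarrow> continuous_homogeneous_polynomial k (Q k)"
    "P = (\<lambda>x. \<Sum>k\<le>n. Q k x)"
    using assms unfolding continuous_polynomial_def by (auto simp: fun_eq_iff)
  have "degree_le n (\<lambda>x. \<Sum>k\<le>n. Q k x)"
    using Q(1) by (intro degree_le_sum) (auto intro: degree_le_mono continuous_homogeneous_polynomial_degree_le)
  then show ?thesis using Q(2) that by simp
qed

lemma continuous_polynomial_continuous:
  assumes "continuous_polynomial P"
  shows "continuous_on UNIV P"
proof -
  obtain n Q where Q: "\<And>k. k \<le> n \<Longrightarrow> continuous_homogeneous_polynomial k (Q k)"
    "P = (\<lambda>x. \<Sum>k\<le>n. Q k x)"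
    using assms unfolding continuous_polynomial_def by (auto simp: fun_eq_iff)
  show ?thesis
    unfolding Q(2) using Q(1)
    by (intro continuous_on_sum) (auto intro: continuous_homogeneous_polynomial_continuous)
qed

lemma continuous_polynomial_bounded:
  assumes "continuous_polynomial P"
  obtains C where "\<And>x. norm x \<le> R \<Longrightarrow> norm (P x) \<le> C"
proof -
  obtain n Q where Q: "\<And>k. k \<le> n \<Longrightarrow> continuous_homogeneous_polynomial k (Q k)"
    "P = (\<lambda>x. \<Sum>k\<le>n. Q k x)"
    using assms unfolding continuous_polynomial_def by (auto simp: fun_eq_iff)
  have "\<exists>C. \<forall>x. norm (Q k x) \<le> C * norm x ^ k" if "k \<le> n" for k
    using continuous_homogeneous_polynomial_bound[OF Q(1)[OF that]] by blast
  then obtain C where C: "\<And>k x. k \<le> n \<Longrightarrow> norm (Q k x) \<le> C k * norm x ^ k"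
    by metis
  have "norm (P x) \<le> (\<Sum>k\<le>n. \<bar>C k\<bar> * R ^ k)" if "norm x \<le> R" for x
    unfolding Q(2)
  proof (rule sum_norm_le)
    fix k assume "k \<in> {..n}"
    then have "norm (Q k x) \<le> C k * norm x ^ k" using C by simp
    also have "\<dots> \<le> \<bar>C k\<bar> * R ^ k"
      using that by (intro mult_mono power_mono) auto
    finally show "norm (Q k x) \<le> \<bar>C k\<bar> * R ^ k" .
  qed
  then show ?thesis by (rule that)
qed

text \<open>
  Polynomials are weakly sequentially continuous along sequences with bounded partial sums (such as
  the unit vector basis of \<open>c\<^sub>0\<close>). Otherwise \<open>q(u + h n) - q u \<ge> e\<close> for infinitely many \<open>n\<close>, up to the
  sign of \<open>q\<close>. The difference of \<open>q\<close> in a direction \<open>v\<close> has smaller degree, so for late \<open>n\<close> the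
  increment \<open>q(u + v + h n) - q(u + v)\<close> is almost the same and at least \<open>e / 2\<close>. Collecting such
  terms one after another in \<open>v\<close>, one makes \<open>q\<close> unbounded on a bounded set.
\<close>

lemma degree_le_tendsto:
  fixes q :: "'a::real_normed_vector \<Rightarrow> real"
  assumes "degree_le d q"
    and bounded: "\<And>R. \<exists>C. \<forall>x. norm x \<le> R \<longrightarrow> \<bar>q x\<bar> \<le> C"
    and sums: "\<And>T. finite T \<Longrightarrow> norm (\<Sum>i\<in>T. h i) \<le> K"
  shows "(\<lambda>n::nat. q (u + h n)) \<longlonglongrightarrow> q u"
  using assms(1) bounded
proof (induction d arbitrary: q)
  case 0
  then have "q (u + h n) = q u" for n by simp
  then show ?case by simp
next
  case (Suc d)
  have upper: "\<forall>\<^sub>F n in sequentially. q (u + h n) - q u < e"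
    if q: "degree_le (Suc d) q" "\<And>R. \<exists>C. \<forall>x. norm x \<le> R \<longrightarrow> \<bar>q x\<bar> \<le> C" and e: "e > 0"
    for q :: "'a \<Rightarrow> real" and e
  proof (rule ccontr)
    assume "\<not> ?thesis"
    then have often: "\<exists>\<^sub>F n in sequentially. e \<le> q (u + h n) - q u"
      by (simp add: frequently_def not_le)
    have lim: "(\<lambda>n. q (u + h n + v) - q (u + h n)) \<longlonglongrightarrow> q (u + v) - q u" for v
    proof (rule Suc.IH)
      show "degree_le d (\<lambda>x. q (x + v) - q x)" using q(1) by simp
      fix R
      obtain C where C: "\<And>x. norm x \<le> R + norm v \<Longrightarrow> \<bar>q x\<bar> \<le> C"
        using q(2) by blast
      have "\<bar>q (x + v) - q x\<bar> \<le> 2 * C" if "norm x \<le> R" for x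
        using C[of "x + v"] C[of x] that norm_triangle_ineq[of x v] norm_ge_zero[of v] by linarith
      then show "\<exists>C. \<forall>x. norm x \<le> R \<longrightarrow> \<bar>q (x + v) - q x\<bar> \<le> C" by blast
    qed
    have grow: "\<exists>T. finite T \<and> q u + k * (e / 2) \<le> q (u + (\<Sum>i\<in>T. h i))" for k :: nat
    proof (induction k)
      case 0
      show ?case by (rule exI[of _ "{}"]) simp
    next
      case (Suc k)
      then obtain T where T: "finite T" "q u + k * (e / 2) \<le> q (u + (\<Sum>i\<in>T. h i))" by blast
      define v where "v = (\<Sum>i\<in>T. h i)"
      have "\<forall>\<^sub>F n in sequentially. q (u + v) - q u - e / 2 < q (u + h n + v) - q (u + h n)"
        using e by (intro order_tendstoD(1)[OF lim]) auto
      moreover have "\<forall>\<^sub>F n in sequentially. n \<notin> T"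
        using T(1) by (simp add: cofinite_eq_sequentially[symmetric] eventually_cofinite)
      ultimately have "\<exists>\<^sub>F n in sequentially. e \<le> q (u + h n) - q u \<and>
          (q (u + v) - q u - e / 2 < q (u + h n + v) - q (u + h n) \<and> n \<notin> T)"
        using often by (intro frequently_eventually_frequently eventually_conj)
      then obtain n where n: "e \<le> q (u + h n) - q u" "n \<notin> T"
        "q (u + v) - q u - e / 2 < q (u + h n + v) - q (u + h n)"
        using frequently_ex by blast
      have eq: "u + (\<Sum>i\<in>insert n T. h i) = u + h n + v"
        using T(1) n(2) by (simp add: v_def)
      moreover have "real (Suc k) * (e / 2) = k * (e / 2) + e / 2"
        by (simp add: algebra_simps)
      ultimately have "q u + Suc k * (e / 2) \<le> q (u + (\<Sum>i\<in>insert n T. h i))"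
        unfolding eq using n(1,3) T(2)[folded v_def] by linarith
      then show ?case using T(1) by blast
    qed
    obtain C where C: "\<And>x. norm x \<le> norm u + K \<Longrightarrow> \<bar>q x\<bar> \<le> C"
      using q(2) by blast
    obtain k :: nat where "C - q u < k * (e / 2)"
      using spec[OF reals_Archimedean3[of "e / 2"], of "C - q u"] e by auto
    moreover obtain T where T: "finite T" "q u + k * (e / 2) \<le> q (u + (\<Sum>i\<in>T. h i))"
      using grow by blast
    moreover have "\<bar>q (u + (\<Sum>i\<in>T. h i))\<bar> \<le> C"
      using C norm_triangle_ineq[of u "\<Sum>i\<in>T. h i"] sums[OF T(1)] by force
    ultimately show False by linarith
  qed
  show ?case
  proof (rule order_tendstoI)
    fix a assume "a > q u"
    then show "\<forall>\<^sub>F n in sequentially. q (u + h n) < a"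
      using upper[OF Suc.prems, of "a - q u"] by simp
  next
    fix a assume a: "a < q u"
    have "degree_le (Suc d) (\<lambda>x. - q x)"
      by (rule degree_le_linear_comp[OF _ Suc.prems(1)]) simp
    from upper[OF this, of "q u - a"] a Suc.prems(2)
    show "\<forall>\<^sub>F n in sequentially. a < q (u + h n)"
      by (simp add: algebra_simps)
  qed
qed

lemma norm_le_polynomial_norm:
  assumes "continuous_polynomial P" "norm x \<le> 1"
  shows "norm (P x) \<le> polynomial_norm P"
proof -
  obtain C where "\<And>x. norm x \<le> 1 \<Longrightarrow> norm (P x) \<le> C"
    using continuous_polynomial_bounded[OF assms(1)] by metis
  then have "bdd_above ((\<lambda>x. norm (P x)) ` cball 0 1)"
    by (intro bdd_aboveI[of _ C]) auto
  with assms(2) show ?thesis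
    unfolding polynomial_norm_def by (intro cSUP_upper) auto
qed

text \<open>
  The radius must stay strictly below \<open>1\<close>: this leaves room for the bumps that are added later.
\<close>

lemma polynomial_norm_approximated_inside:
  assumes P: "continuous_polynomial P" and c: "c < polynomial_norm P"
  obtains x where "norm x < 1" "c < norm (P x)"
proof -
  have "\<not> (\<forall>x\<in>cball 0 1. norm (P x) \<le> c)"
  proof
    assume "\<forall>x\<in>cball 0 1. norm (P x) \<le> c"
    then have "polynomial_norm P \<le> c"
      unfolding polynomial_norm_def by (intro cSUP_least) auto
    with c show False by simp
  qed
  then obtain x where x: "norm x \<le> 1" "c < norm (P x)" by auto
  define y where "y n = (real n / real (Suc n)) *\<^sub>R x" for n
  have "y \<longlonglongrightarrow> 1 *\<^sub>R x"
    unfolding y_def by (intro tendsto_intros LIMSEQ_n_over_Suc_n)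
  then have "(\<lambda>n. norm (P (y n))) \<longlonglongrightarrow> norm (P x)"
    using continuous_on_tendsto_compose[OF continuous_polynomial_continuous[OF P], of y x]
    by (auto intro: tendsto_norm)
  from order_tendstoD(1)[OF this x(2)] obtain n where "c < norm (P (y n))"
    by (auto simp: eventually_sequentially)
  moreover have "norm (y n) \<le> real n / real (Suc n) * 1"
    unfolding y_def norm_scaleR using x(1) by (intro mult_mono) auto
  then have "norm (y n) < 1"
    by (rule le_less_trans) (simp add: divide_less_eq)
  ultimately show ?thesis using that by blast
qed

section \<open>Cluster points\<close>

text \<open>
  The sequence lies in a product of compact intervals, hence has a pointwise cluster point by
  Tychonoff's theorem. Linearity and boundedness involve finitely many points at a time, so the
  cluster point inherits them.
\<close>

lemma cluster_functional:
  fixes m :: "nat \<Rightarrow> 'x::real_normed_vector \<Rightarrow>\<^sub>L real"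
  assumes norm_le: "\<And>n. norm (m n) \<le> 1"
  obtains \<phi> :: "'x \<Rightarrow>\<^sub>L real" where
    "\<And>G e N. finite G \<Longrightarrow> e > 0 \<Longrightarrow> \<exists>n\<ge>N. \<forall>g\<in>G. \<bar>m n g - \<phi> g\<bar> < e"
proof -
  define K where "K = (\<Pi>\<^sub>E g\<in>UNIV. {- norm g .. norm (g :: 'x)})"
  have "compactin (product_topology (\<lambda>_. euclideanreal) UNIV) K"
    unfolding K_def by (simp add: compactin_PiE)
  then have K: "compact K"
    by (simp add: euclidean_product_topology)
  have bound: "\<bar>m n g\<bar> \<le> norm g" for n g
    using norm_blinfun[of "m n" g] mult_right_mono[OF norm_le[of n] norm_ge_zero[of g]] by simp
  have "\<forall>\<^sub>F \<psi> in filtermap (\<lambda>n. blinfun_apply (m n)) sequentially. \<psi> \<in> K"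
    using bound by (auto simp: eventually_filtermap K_def abs_le_iff minus_le_iff
        intro!: always_eventually)
  then obtain \<psi> where \<psi>: "inf (nhds \<psi>) (filtermap (\<lambda>n. blinfun_apply (m n)) sequentially) \<noteq> bot"
    using K unfolding compact_filter by (metis filtermap_bot_iff sequentially_bot)
  have cluster: "\<exists>n\<ge>N. \<forall>g\<in>G. \<bar>m n g - \<psi> g\<bar> < e" if "finite G" "e > 0" for G e N
  proof (rule ccontr)
    assume none: "\<not> ?thesis"
    have "\<forall>\<^sub>F \<xi> in nhds \<psi>. \<forall>g\<in>G. \<bar>\<xi> g - \<psi> g\<bar> < e"
    proof (intro eventually_ball_finite that(1) ballI)
      fix g
      have "open ((\<lambda>\<xi> :: 'x \<Rightarrow> real. \<xi> g) -` ball (\<psi> g) e)"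
        by (intro open_vimage continuous_on_product_coordinates open_ball)
      moreover have "\<psi> \<in> (\<lambda>\<xi>. \<xi> g) -` ball (\<psi> g) e"
        using that(2) by simp
      ultimately show "\<forall>\<^sub>F \<xi> in nhds \<psi>. \<bar>\<xi> g - \<psi> g\<bar> < e"
        unfolding eventually_nhds by (force simp: dist_real_def abs_minus_commute)
    qed
    moreover have "\<forall>\<^sub>F \<xi> in filtermap (\<lambda>n. blinfun_apply (m n)) sequentially. \<not> (\<forall>g\<in>G. \<bar>\<xi> g - \<psi> g\<bar> < e)"
      using none by (auto simp: eventually_filtermap eventually_sequentially)
    ultimately have "\<forall>\<^sub>F \<xi> in inf (nhds \<psi>) (filtermap (\<lambda>n. blinfun_apply (m n)) sequentially). False"
      unfolding eventually_inf by blast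
    with \<psi> show False by (simp add: eventually_False)
  qed
  have add: "\<psi> (a + b) = \<psi> a + \<psi> b" for a b
  proof (rule ccontr)
    assume "\<psi> (a + b) \<noteq> \<psi> a + \<psi> b"
    then have "\<bar>\<psi> (a + b) - (\<psi> a + \<psi> b)\<bar> / 3 > 0" by simp
    from cluster[OF _ this, of "{a, b, a + b}" 0] obtain n
      where "\<bar>m n a - \<psi> a\<bar> < \<bar>\<psi> (a + b) - (\<psi> a + \<psi> b)\<bar> / 3"
        "\<bar>m n b - \<psi> b\<bar> < \<bar>\<psi> (a + b) - (\<psi> a + \<psi> b)\<bar> / 3"
        "\<bar>m n a + m n b - \<psi> (a + b)\<bar> < \<bar>\<psi> (a + b) - (\<psi> a + \<psi> b)\<bar> / 3"
      by (auto simp: blinfun.add_right)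
    then show False by argo
  qed
  have scale: "\<psi> (r *\<^sub>R a) = r * \<psi> a" for r a
  proof (rule ccontr)
    assume neq: "\<psi> (r *\<^sub>R a) \<noteq> r * \<psi> a"
    define e where "e = \<bar>\<psi> (r *\<^sub>R a) - r * \<psi> a\<bar> / (1 + \<bar>r\<bar>)"
    have e: "e > 0" using neq by (simp add: e_def add_pos_nonneg)
    from cluster[OF _ this, of "{a, r *\<^sub>R a}" 0] obtain n
      where n: "\<bar>m n a - \<psi> a\<bar> < e" "\<bar>m n (r *\<^sub>R a) - \<psi> (r *\<^sub>R a)\<bar> < e" by auto
    have "\<bar>r * m n a - r * \<psi> a\<bar> \<le> \<bar>r\<bar> * e"
      using n(1) by (simp add: right_diff_distrib[symmetric] abs_mult mult_left_mono)
    then have "\<bar>\<psi> (r *\<^sub>R a) - r * \<psi> a\<bar> < (1 + \<bar>r\<bar>) * e"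
      using n(2) by (simp add: blinfun.scaleR_right algebra_simps)
    then show False by (simp add: e_def)
  qed
  have "\<bar>\<psi> g\<bar> \<le> norm g" for g
  proof (rule field_le_epsilon)
    fix e :: real assume "e > 0"
    from cluster[OF _ this, of "{g}" 0] obtain n where "\<bar>m n g - \<psi> g\<bar> < e" by auto
    with bound[of n g] show "\<bar>\<psi> g\<bar> \<le> norm g + e" by linarith
  qed
  then have "bounded_linear \<psi>"
    using add scale by (intro bounded_linear_intro[of _ 1]) auto
  then have "blinfun_apply (Blinfun \<psi>) = \<psi>" by (simp add: bounded_linear_Blinfun_apply)
  with cluster that[of "Blinfun \<psi>"] show ?thesis by simp
qed

lemma relatively_weakly_compact_cluster_point:
  assumes "relatively_weakly_compact S" and s: "\<And>k::nat. s k \<in> S"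
  obtains z where "\<And>(\<psi> :: 'x::real_normed_vector \<Rightarrow>\<^sub>L real) e N. e > 0 \<Longrightarrow> \<exists>k\<ge>N. \<bar>\<psi> (s k) - \<psi> z\<bar> < e"
proof (rule ccontr)
  let ?T = "weak_topology :: 'x topology"
  assume none: "\<not> thesis"
  have "\<forall>z. \<exists>p :: ('x \<Rightarrow>\<^sub>L real) \<times> real \<times> nat. fst (snd p) > 0 \<and>
      (\<forall>k\<ge>snd (snd p). \<not> \<bar>blinfun_apply (fst p) (s k) - blinfun_apply (fst p) z\<bar> < fst (snd p))"
  proof (rule allI, rule ccontr)
    fix z
    assume no: "\<nexists>p :: ('x \<Rightarrow>\<^sub>L real) \<times> real \<times> nat. fst (snd p) > 0 \<and>
      (\<forall>k\<ge>snd (snd p). \<not> \<bar>blinfun_apply (fst p) (s k) - blinfun_apply (fst p) z\<bar> < fst (snd p))"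
    have "\<exists>k\<ge>N. \<bar>\<psi> (s k) - \<psi> z\<bar> < e" if "e > 0" for \<psi> :: "'x \<Rightarrow>\<^sub>L real" and e N
      using spec[OF no[unfolded not_ex], of "(\<psi>, e, N)"] that by auto
    then have thesis by (rule that[of z])
    with none show False ..
  qed
  from choice[OF this] obtain p :: "'x \<Rightarrow> ('x \<Rightarrow>\<^sub>L real) \<times> real \<times> nat" where p:
    "\<forall>z. fst (snd (p z)) > 0 \<and>
      (\<forall>k\<ge>snd (snd (p z)). \<not> \<bar>blinfun_apply (fst (p z)) (s k) - blinfun_apply (fst (p z)) z\<bar> < fst (snd (p z)))" ..
  define \<psi> e N where "\<psi> z = fst (p z)" and "e z = fst (snd (p z))" and "N z = snd (snd (p z))" for z
  have far: "e z > 0" "k \<ge> N z \<Longrightarrow> \<not> \<bar>\<psi> z (s k) - \<psi> z z\<bar> < e z" for z k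
    using p by (auto simp: \<psi>_def e_def N_def)
  \<comment> \<open>Otherwise each point has a weak neighbourhood that the sequence finally leaves, and finitely
    many of these neighbourhoods cover the closure.\<close>
  define U where "U z = blinfun_apply (\<psi> z) -` ball (\<psi> z z) (e z)" for z
  have centre: "z \<in> U z" for z
    using far(1) by (simp add: U_def)
  have sub: "openin ?T (blinfun_apply \<phi> -` V)" if "open V" for \<phi> :: "'x \<Rightarrow>\<^sub>L real" and V
    unfolding weak_topology_def by (rule topology_generated_by_Basis) (use that in blast)
  have "openin ?T UNIV"
    using sub[of UNIV 0] by simp
  then have top: "topspace ?T = UNIV"
    using openin_subset by auto
  define K where "K = ?T closure_of S"
  have sK: "s k \<in> K" for k
    using closure_of_subset[of S ?T] s top by (auto simp: K_def)
  have "compactin ?T K"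
    using assms(1) by (simp add: relatively_weakly_compact_def K_def)
  moreover have "\<forall>V\<in>range U. openin ?T V"
    using sub by (auto simp: U_def)
  moreover have "K \<subseteq> \<Union>(range U)"
    using centre by blast
  ultimately obtain F where "finite F" "F \<subseteq> range U" "K \<subseteq> \<Union>F"
    unfolding compactin_def by meson
  then obtain Z where Z: "finite Z" "K \<subseteq> (\<Union>z\<in>Z. U z)"
    by (metis finite_subset_image)
  obtain M where M: "\<And>z. z \<in> Z \<Longrightarrow> N z \<le> M"
    using Z(1) by (metis finite_imageI image_eqI Max_ge)
  obtain z where "z \<in> Z" "s M \<in> U z"
    using sK Z(2) by blast
  then show False
    using far(2)[OF M] by (auto simp: U_def dist_real_def abs_minus_commute)
qed

section \<open>Weakly compact polynomials along bounded partial sums\<close>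

lemma polynomial_along_sequence_tendsto:
  fixes P :: "'x::real_normed_vector \<Rightarrow> 'y::real_normed_vector" and \<phi> :: "'y \<Rightarrow>\<^sub>L real"
  assumes P: "continuous_polynomial P"
    and sums: "\<And>T. finite T \<Longrightarrow> norm (\<Sum>i\<in>T. h i) \<le> K"
  shows "(\<lambda>n::nat. \<phi> (P (u + h n))) \<longlonglongrightarrow> \<phi> (P u)"
proof -
  obtain d where "degree_le d P"
    using continuous_polynomial_degree_le[OF P] .
  then have "degree_le d (\<lambda>x. \<phi> (P x))"
    by (rule degree_le_linear_comp[rotated]) (simp add: blinfun.diff_right)
  moreover have "\<exists>C. \<forall>x. norm x \<le> R \<longrightarrow> \<bar>\<phi> (P x)\<bar> \<le> C" for R
  proof -
    obtain C where C: "\<And>x. norm x \<le> R \<Longrightarrow> norm (P x) \<le> C"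
      using continuous_polynomial_bounded[OF P] by metis
    have "\<bar>\<phi> (P x)\<bar> \<le> norm \<phi> * C" if "norm x \<le> R" for x
      using norm_blinfun[of \<phi> "P x"] mult_left_mono[OF C[OF that] norm_ge_zero[of \<phi>]] by simp
    then show ?thesis by blast
  qed
  ultimately show ?thesis
    using sums by (rule degree_le_tendsto)
qed

text \<open>
  Let \<open>\<phi>\<close> be a cluster point of the functionals \<open>m n\<close>, so \<open>\<phi>(P f) \<ge> c\<close>. Choose indices
  \<open>r 0 < r 1 < \<dots>\<close>, each one so late that, with \<open>s k = P(f + h (r 0) + \<dots> + h (r (k - 1)))\<close>, the functional
  \<open>m (r k)\<close> is close to \<open>\<phi>\<close> at \<open>s 0, \<dots>, s k\<close>, and the step from \<open>s k\<close> to \<open>s (k + 1)\<close> is hardly seen by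
  \<open>\<phi>\<close> and by the functionals \<open>m (r j)\<close> with \<open>j < k\<close>. Then \<open>m (r k) (s j)\<close> is about \<open>\<phi>(P f)\<close> for
  \<open>j \<le> k\<close>, and about \<open>m (r k) (s (k + 1))\<close> for \<open>j > k\<close>. Weak compactness gives a weak cluster point \<open>z\<close>
  of \<open>s\<close>, at which both iterated limits can be read off, so they agree. This means that some
  \<open>m (r k) (s (k + 1))\<close> is about \<open>\<phi>(P f)\<close>.
\<close>

lemma weakly_compact_polynomial_diagonal:
  fixes P :: "'x::real_normed_vector \<Rightarrow> 'y::real_normed_vector"
    and m :: "nat \<Rightarrow> 'y \<Rightarrow>\<^sub>L real"
  assumes P: "continuous_polynomial P" "weakly_compact_map P"
    and ball: "\<And>T. finite T \<Longrightarrow> norm (f + (\<Sum>i\<in>T. h i)) \<le> 1"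
    and m: "\<And>n. norm (m n) \<le> 1" "\<And>n. c \<le> m n (P f)"
    and d: "d > 0"
  obtains T n where "finite T" "n \<in> T" "c - d \<le> m n (P (f + (\<Sum>i\<in>T. h i)))"
proof -
  \<comment> \<open>Eight approximations, each up to \<open>e\<close>, lead from \<open>c\<close> to the final estimate.\<close>
  define e where "e = d / 8"
  have e: "e > 0" using d by (simp add: e_def)
  have sums: "norm (\<Sum>i\<in>T. h i) \<le> 2" if "finite T" for T
    using norm_triangle_ineq4[of "f + (\<Sum>i\<in>T. h i)" f] ball[OF that] ball[of "{}"] by simp
  obtain \<phi> :: "'y \<Rightarrow>\<^sub>L real" where \<phi>:
    "\<And>G e N. finite G \<Longrightarrow> e > 0 \<Longrightarrow> \<exists>n\<ge>N. \<forall>g\<in>G. \<bar>m n g - \<phi> g\<bar> < e"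
    using cluster_functional[of m] m(1) by metis
  have \<phi>f: "c - e \<le> \<phi> (P f)"
    using \<phi>[of "{P f}" e 0] e m(2) by (auto simp: abs_less_iff) (smt (verit))
  define u where "u r k = f + (\<Sum>j<k. h (r j))" for r :: "nat \<Rightarrow> nat" and k
  define good where "good r k n \<longleftrightarrow> (\<forall>j<k. r j < n) \<and>
      (\<forall>i\<le>k. \<bar>m n (P (u r i)) - \<phi> (P (u r i))\<bar> < e) \<and>
      (\<forall>\<psi>\<in>insert \<phi> ((\<lambda>j. m (r j)) ` {..<k}). \<bar>\<psi> (P (u r k + h n)) - \<psi> (P (u r k))\<bar> < e / 2 ^ Suc k)"
    for r k n
  have "\<exists>r. \<forall>k. good r k (r k)"
  proof (rule dependent_wellorder_choice)
    fix n k and r r' :: "nat \<Rightarrow> nat"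
    assume eq: "\<And>j. j < k \<Longrightarrow> r j = r' j"
    then have "u r i = u r' i" if "i \<le> k" for i
      using that by (simp add: u_def)
    with eq show "good r k n = good r' k n"
      by (simp add: good_def)
  next
    fix k and r :: "nat \<Rightarrow> nat"
    have "\<forall>\<^sub>F n in sequentially. \<forall>\<psi>\<in>insert \<phi> ((\<lambda>j. m (r j)) ` {..<k}).
        \<bar>\<psi> (P (u r k + h n)) - \<psi> (P (u r k))\<bar> < e / 2 ^ Suc k"
    proof (intro eventually_ball_finite ballI)
      fix \<psi> :: "'y \<Rightarrow>\<^sub>L real"
      have "e / 2 ^ Suc k > 0" using e by simp
      from tendstoD[OF polynomial_along_sequence_tendsto[OF P(1) sums] this]
      show "\<forall>\<^sub>F n in sequentially. \<bar>\<psi> (P (u r k + h n)) - \<psi> (P (u r k))\<bar> < e / 2 ^ Suc k"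
        by (simp add: dist_real_def)
    qed simp
    moreover have "\<forall>\<^sub>F n in sequentially. \<forall>j\<in>{..<k}. r j < n"
      by (intro eventually_ball_finite ballI eventually_gt_at_top) simp
    ultimately have "\<forall>\<^sub>F n in sequentially. (\<forall>\<psi>\<in>insert \<phi> ((\<lambda>j. m (r j)) ` {..<k}).
        \<bar>\<psi> (P (u r k + h n)) - \<psi> (P (u r k))\<bar> < e / 2 ^ Suc k) \<and> (\<forall>j\<in>{..<k}. r j < n)"
      by (rule eventually_conj)
    then obtain N where N: "\<And>n. n \<ge> N \<Longrightarrow> (\<forall>\<psi>\<in>insert \<phi> ((\<lambda>j. m (r j)) ` {..<k}).
        \<bar>\<psi> (P (u r k + h n)) - \<psi> (P (u r k))\<bar> < e / 2 ^ Suc k) \<and> (\<forall>j\<in>{..<k}. r j < n)"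
      unfolding eventually_sequentially by blast
    obtain n where "n \<ge> N" "\<forall>g\<in>(\<lambda>i. P (u r i)) ` {..k}. \<bar>m n g - \<phi> g\<bar> < e"
      using \<phi>[of "(\<lambda>i. P (u r i)) ` {..k}" e N] e by auto
    with N[of n] have "good r k n" unfolding good_def by auto
    then show "\<exists>n. good r k n" by blast
  qed
  then obtain r where "\<And>k. good r k (r k)" by blast
  then have less: "\<And>j k. j < k \<Longrightarrow> r j < r k"
    and near: "\<And>i k. i \<le> k \<Longrightarrow> \<bar>m (r k) (P (u r i)) - \<phi> (P (u r i))\<bar> < e"
    and small: "\<And>k \<psi>. \<psi> = \<phi> \<or> \<psi> \<in> (\<lambda>j. m (r j)) ` {..<k} \<Longrightarrow>
        \<bar>\<psi> (P (u r k + h (r k))) - \<psi> (P (u r k))\<bar> < e / 2 ^ Suc k"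
    unfolding good_def by blast+
  define s where "s k = P (u r k)" for k
  have u_sum: "u r k = f + (\<Sum>i\<in>r ` {..<k}. h i)" for k
    unfolding u_def using less by (subst sum.reindex) (auto simp: inj_on_def; metis nat_neq_iff)+
  have s_Suc: "P (u r k + h (r k)) = s (Suc k)" for k
    by (simp add: s_def u_def add.assoc)
  \<comment> \<open>The steps are at most \<open>e / 2\<close>, \<open>e / 4\<close>, and so on, and \<open>m (r i)\<close> controls only those after step \<open>i\<close>.\<close>
  have drift: "\<bar>\<psi> (s k) - \<psi> (s j)\<bar> \<le> e"
    if "j \<le> k" and \<psi>: "\<And>i. i \<ge> j \<Longrightarrow> \<psi> = \<phi> \<or> \<psi> \<in> (\<lambda>j. m (r j)) ` {..<i}" for j k \<psi>
  proof -
    have "\<bar>\<psi> (s k) - \<psi> (s j)\<bar> \<le> e / 2 ^ j - e / 2 ^ k"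
      using that(1)
    proof (induction rule: dec_induct)
      case (step i)
      from small[OF \<psi>, of i] step show ?case
        by (simp add: s_Suc) (simp add: s_def)
    qed simp
    also have "\<dots> \<le> e / 2 ^ j"
      using e by simp
    also have "\<dots> \<le> e / 1"
      using e by (intro divide_left_mono) auto
    finally show ?thesis by simp
  qed
  \<comment> \<open>A second cluster functional is needed: the indices \<open>r k\<close> need not be among those along which
    \<open>m n\<close> approaches \<open>\<phi>\<close> at \<open>z\<close>.\<close>
  obtain \<phi>' :: "'y \<Rightarrow>\<^sub>L real" where \<phi>':
    "\<And>G e N. finite G \<Longrightarrow> e > 0 \<Longrightarrow> \<exists>k\<ge>N. \<forall>g\<in>G. \<bar>m (r k) g - \<phi>' g\<bar> < e"
    using cluster_functional[of "\<lambda>k. m (r k)"] m(1) by metis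
  have "s k \<in> P ` cball 0 1" for k
    using ball[of "r ` {..<k}"] by (simp add: s_def u_sum)
  then obtain z where z: "\<And>(\<psi> :: 'y \<Rightarrow>\<^sub>L real) e N. e > 0 \<Longrightarrow> \<exists>k\<ge>N. \<bar>\<psi> (s k) - \<psi> z\<bar> < e"
    using relatively_weakly_compact_cluster_point[of "P ` cball 0 1" s] P(2)
    unfolding weakly_compact_map_def by metis
  \<comment> \<open>First let the functional go to its limit, then \<open>s k\<close>.\<close>
  have "c - 4 * e \<le> \<phi>' (s k)" for k
  proof -
    obtain l where "l \<ge> k" "\<bar>m (r l) (s k) - \<phi>' (s k)\<bar> < e"
      using \<phi>'[of "{s k}" e k] e by auto
    moreover have "\<bar>m (r l) (s k) - \<phi> (s k)\<bar> < e"
      using near[OF \<open>l \<ge> k\<close>] by (simp add: s_def)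
    moreover have "\<bar>\<phi> (s k) - \<phi> (s 0)\<bar> \<le> e"
      by (rule drift) auto
    moreover have "s 0 = P f" by (simp add: s_def u_def)
    ultimately show ?thesis using \<phi>f by (simp add: abs_le_iff abs_less_iff)
  qed
  then have "c - 5 * e \<le> \<phi>' z"
    using z[of e 0 \<phi>'] e by (auto simp: abs_less_iff) (smt (verit))
  \<comment> \<open>Now the other order: fix the functional \<open>m (r j)\<close> and let \<open>s k\<close> approach \<open>z\<close>.\<close>
  moreover obtain j where "\<bar>m (r j) z - \<phi>' z\<bar> < e"
    using \<phi>'[of "{z}" e 0] e by auto
  moreover obtain k where k: "k \<ge> Suc j" "\<bar>m (r j) (s k) - m (r j) z\<bar> < e"
    using z[of e "Suc j" "m (r j)"] e by auto
  moreover have "\<bar>m (r j) (s k) - m (r j) (s (Suc j))\<bar> \<le> e"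
    using k(1) by (rule drift) auto
  ultimately have "c - d \<le> m (r j) (s (Suc j))"
    unfolding e_def abs_le_iff abs_less_iff by argo
  then show ?thesis
    using that[of "r ` {..<Suc j}" "r j"] by (simp add: s_def u_sum)
qed

section \<open>Slopes and norms of Lipschitz functions\<close>

text \<open>
  Subtracting the value at the distinguished point changes no slope. So functions can be
  constructed without regard to it.
\<close>

definition lip0_of :: "('m::{metric_space,zero} \<Rightarrow> real) \<Rightarrow> 'm lip0" where
  "lip0_of F = Lip0 (\<lambda>t. F t - F 0)"

lemma
  assumes "C-lipschitz_on UNIV F"
  shows lip0_apply_lip0_of: "lip0_apply (lip0_of F) t = F t - F 0"
    and norm_lip0_of_le: "norm (lip0_of F) \<le> C"
proof -
  have L: "C-lipschitz_on UNIV (\<lambda>t. F t - F 0)"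
    using assms by (auto simp: lipschitz_on_def dist_real_def)
  then have *: "lip0_apply (lip0_of F) = (\<lambda>t. F t - F 0)"
    unfolding lip0_of_def by (intro Lip0_inverse) auto
  then show "lip0_apply (lip0_of F) t = F t - F 0" by simp
  show "norm (lip0_of F) \<le> C"
    unfolding norm_lip0.rep_eq * using L by (rule lipschitz_const_le)
qed

definition slope :: "'m::{metric_space,zero} \<Rightarrow> 'm \<Rightarrow> 'm lip0 \<Rightarrow>\<^sub>L real" where
  "slope a b = Blinfun (\<lambda>f. (lip0_apply f a - lip0_apply f b) / dist a b)"

lemma slope_apply: "slope a b f = (lip0_apply f a - lip0_apply f b) / dist a b"
  and norm_slope_le: "norm (slope a b) \<le> 1"
proof -
  have bound: "\<bar>(lip0_apply f a - lip0_apply f b) / dist a b\<bar> \<le> norm f" for f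
    using lipschitz_quotient_le[OF lip0_apply_lipschitz_on, of f a b] by simp
  have "bounded_linear (\<lambda>f. (lip0_apply f a - lip0_apply f b) / dist a b)"
  proof (rule bounded_linear_intro[of _ 1])
    show "norm ((lip0_apply f a - lip0_apply f b) / dist a b) \<le> norm f * 1" for f
      using bound by simp
  qed (simp_all add: plus_lip0.rep_eq scaleR_lip0.rep_eq diff_divide_distrib add_divide_distrib
      right_diff_distrib)
  then have *: "blinfun_apply (slope a b) f = (lip0_apply f a - lip0_apply f b) / dist a b" for f
    by (simp add: slope_def bounded_linear_Blinfun_apply)
  show "slope a b f = (lip0_apply f a - lip0_apply f b) / dist a b" by (rule *)
  show "norm (slope a b) \<le> 1"
    using bound by (intro norm_blinfun_bound) (auto simp: *)
qed

lemma slope_le_norm: "slope a b f \<le> norm f"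
  using norm_blinfun[of "slope a b" f] mult_right_mono[OF norm_slope_le[of a b] norm_ge_zero[of f]]
  by simp

lemma exists_slope_gt:
  assumes "c < norm f" "c \<ge> 0"
  obtains a b where "a \<noteq> b" "c < slope a b f"
proof (rule ccontr)
  assume "\<not> thesis"
  then have le: "slope a b f \<le> c" if "a \<noteq> b" for a b
    using that \<open>\<And>b a. a \<noteq> b \<Longrightarrow> c < slope a b f \<Longrightarrow> thesis\<close> by force
  have "c-lipschitz_on UNIV (lip0_apply f)"
  proof (rule lipschitz_onI)
    fix a b
    show "dist (lip0_apply f a) (lip0_apply f b) \<le> c * dist a b"
      using le[of a b] le[of b a]
      by (cases "a = b") (auto simp: slope_apply dist_real_def divide_le_eq dist_commute)
  qed fact
  then have "norm f \<le> c"
    unfolding norm_lip0.rep_eq by (rule lipschitz_const_le)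
  with assms show False by simp
qed

lemma lip0_apply_diff_le:
  assumes "norm f \<le> 1"
  shows "lip0_apply f x - lip0_apply f y \<le> dist x y"
  using lipschitz_onD[OF lip0_apply_lipschitz_on[of f], of x y]
    mult_right_mono[OF assms zero_le_dist[of x y]]
  by (simp add: dist_real_def)

text \<open>
  A function with slope \<open>1\<close> between \<open>a\<close> and \<open>b\<close> that is steep only along almost geodesic paths from
  \<open>a\<close> to \<open>b\<close>. Up to an additive constant it is \<open>t \<mapsto> (d(a, b) / 2) (d(t, b) - d(t, a)) / (d(t, b) + d(t, a))\<close>. An increment from \<open>v\<close> to \<open>u\<close> is at
  most \<open>d(u, v) d(a, b) / (d(t, a) + d(t, b))\<close>, both for \<open>t = u\<close> and for \<open>t = v\<close>. So a slope of at least \<open>q\<close> puts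
  both points close to the metric segment; and since the function is larger at \<open>u\<close>, that point is
  relatively nearer to \<open>a\<close>.
\<close>

lemma segment_function:
  fixes a b :: "'m::{metric_space,zero}"
  assumes "a \<noteq> b"
  defines "F \<equiv> \<lambda>t. dist a b * dist t b / (dist t a + dist t b)"
  shows segment_function_lipschitz: "1-lipschitz_on UNIV F"
    and segment_function_ends: "F a = dist a b" "F b = 0"
    and segment_function_steep:
      "\<lbrakk>q > 0; q * dist u v \<le> F u - F v; u \<noteq> v\<rbrakk> \<Longrightarrow> q * (dist u a + dist v b) \<le> dist a b"
proof -
  have D: "dist a b > 0" using assms by simp
  have S: "dist a b \<le> dist t a + dist t b" for t
    using dist_triangle[of a b t] by (simp add: dist_commute)
  have S0: "dist t a + dist t b > 0" for t
    using S[of t] D by linarith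
  let ?N = "\<lambda>u v. dist u b * dist v a - dist u a * dist v b"
  have diff: "F u - F v = dist a b * ?N u v / ((dist u a + dist u b) * (dist v a + dist v b))" for u v
    using S0[of u] S0[of v] unfolding F_def by (simp add: field_simps)
  have N1: "?N u v \<le> (dist u a + dist u b) * dist u v" for u v
  proof -
    have "?N u v = dist u b * (dist v a - dist u a) + dist u a * (dist u b - dist v b)"
      by (simp add: algebra_simps)
    also have "\<dots> \<le> dist u b * dist u v + dist u a * dist u v"
      using dist_triangle[of v a u] dist_triangle[of u b v]
      by (intro add_mono mult_left_mono) (auto simp: dist_commute)
    finally show ?thesis by (simp add: algebra_simps)
  qed
  have N2: "?N u v \<le> (dist v a + dist v b) * dist u v" for u v
  proof -
    have "?N u v = dist v b * (dist v a - dist u a) + dist v a * (dist u b - dist v b)"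
      by (simp add: algebra_simps)
    also have "\<dots> \<le> dist v b * dist u v + dist v a * dist u v"
      using dist_triangle[of v a u] dist_triangle[of u b v]
      by (intro add_mono mult_left_mono) (auto simp: dist_commute)
    finally show ?thesis by (simp add: algebra_simps)
  qed
  have le1: "(F u - F v) * (dist v a + dist v b) \<le> dist a b * dist u v" for u v
  proof -
    have "(F u - F v) * (dist v a + dist v b) = dist a b * (?N u v / (dist u a + dist u b))"
      using S0[of u] S0[of v] by (simp add: diff)
    also have "\<dots> \<le> dist a b * dist u v"
      using N1[of u v] S0[of u] by (intro mult_left_mono) (auto simp: divide_le_eq mult.commute)
    finally show ?thesis .
  qed
  have le2: "(F u - F v) * (dist u a + dist u b) \<le> dist a b * dist u v" for u v
  proof -
    have "(F u - F v) * (dist u a + dist u b) = dist a b * (?N u v / (dist v a + dist v b))"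
      using S0[of u] S0[of v] by (simp add: diff)
    also have "\<dots> \<le> dist a b * dist u v"
      using N2[of u v] S0[of v] by (intro mult_left_mono) (auto simp: divide_le_eq mult.commute)
    finally show ?thesis .
  qed
  have le: "F u - F v \<le> dist u v" for u v
  proof (rule ccontr)
    assume gt: "\<not> F u - F v \<le> dist u v"
    then have "dist u v * dist a b < (F u - F v) * dist a b"
      using D by simp
    also have "\<dots> \<le> (F u - F v) * (dist v a + dist v b)"
      using gt zero_le_dist[of u v] by (intro mult_left_mono S) linarith
    also have "\<dots> \<le> dist u v * dist a b" using le1[of u v] by (simp add: mult.commute)
    finally show False by simp
  qed
  show "1-lipschitz_on UNIV F"
  proof (rule lipschitz_onI)
    show "dist (F u) (F v) \<le> 1 * dist u v" for u v
      using le[of u v] le[of v u] by (simp add: dist_real_def abs_le_iff dist_commute)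
  qed simp
  show "F a = dist a b" "F b = 0"
    using D by (auto simp: F_def)
  assume q: "q > 0" "q * dist u v \<le> F u - F v" "u \<noteq> v"
  have "q * (dist u a + dist u b) * dist u v \<le> dist a b * dist u v"
    using le2[of u v] mult_right_mono[OF q(2), of "dist u a + dist u b"] by (simp add: mult_ac)
  then have qu: "q * (dist u a + dist u b) \<le> dist a b"
    by (rule mult_right_le_imp_le) (use q(3) in simp)
  have "q * (dist v a + dist v b) * dist u v \<le> dist a b * dist u v"
    using le1[of u v] mult_right_mono[OF q(2), of "dist v a + dist v b"] by (simp add: mult_ac)
  then have qv: "q * (dist v a + dist v b) \<le> dist a b"
    by (rule mult_right_le_imp_le) (use q(3) in simp)
  \<comment> \<open>The relative positions of \<open>u\<close> and \<open>v\<close>; \<open>y \<le> x\<close> turns the bounds on \<open>d(u, a) + d(u, b)\<close> and on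
    \<open>d(v, a) + d(v, b)\<close> into one on the mixed sum.\<close>
  define x where "x = dist u b / (dist u a + dist u b)"
  define y where "y = dist v b / (dist v a + dist v b)"
  have x: "dist u a = (1 - x) * (dist u a + dist u b)" "x \<le> 1"
    using S0[of u] by (auto simp: x_def field_simps)
  have y: "dist v b = y * (dist v a + dist v b)" "0 \<le> y"
    using S0[of v] by (auto simp: y_def field_simps)
  have "0 \<le> F u - F v"
    using q by (meson mult_nonneg_nonneg less_imp_le order_trans zero_le_dist)
  then have "dist a b * y \<le> dist a b * x"
    by (simp add: F_def x_def y_def)
  then have xy: "y \<le> x" using D by simp
  have "q * (dist u a + dist v b) = (1 - x) * (q * (dist u a + dist u b)) + y * (q * (dist v a + dist v b))"
    by (subst x(1), subst y(1)) (simp add: algebra_simps)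
  also have "\<dots> \<le> (1 - x) * dist a b + y * dist a b"
    using x(2) y(2) qu qv by (intro add_mono mult_left_mono) auto
  also have "\<dots> = (1 - x + y) * dist a b" by (simp add: algebra_simps)
  also have "\<dots> \<le> 1 * dist a b" using xy by (intro mult_right_mono) auto
  finally show "q * (dist u a + dist v b) \<le> dist a b" by simp
qed

section \<open>Short steep pairs from the Daugavet property\<close>

lemma norm_blinfun_gt:
  fixes T :: "'x::real_normed_vector \<Rightarrow>\<^sub>L 'y::real_normed_vector"
  assumes "c < norm T" "c \<ge> 0"
  obtains x where "norm x \<le> 1" "c < norm (T x)"
proof (rule ccontr)
  assume "\<not> thesis"
  with that have le: "norm (T x) \<le> c" if "norm x \<le> 1" for x
    using \<open>norm x \<le> 1\<close> by force
  have "norm T \<le> c"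
  proof (rule norm_blinfun_bound)
    show "norm (T x) \<le> c * norm x" for x
    proof (cases "x = 0")
      case False
      have "norm (T (x /\<^sub>R norm x)) \<le> c"
        using False by (intro le) simp
      then show ?thesis
        using False by (simp add: blinfun.scaleR_right field_simps)
    qed simp
  qed fact
  with assms(1) show False by simp
qed

text \<open>
  The Daugavet equation for the operator \<open>x \<mapsto> \<phi>(x) y\<close>. Replacing \<open>g\<close> by \<open>- g\<close> gives \<open>\<phi> g\<close> the right sign.
\<close>

lemma daugavet_property_slice:
  fixes \<phi> :: "'x::banach \<Rightarrow>\<^sub>L real"
  assumes D: "daugavet_property TYPE('x)" and \<phi>: "norm \<phi> = 1" and y: "norm y = 1"
    and e: "0 < e" "e \<le> 1"
  obtains g where "norm g \<le> 1" "0 \<le> \<phi> g" "2 - e < norm (g + \<phi> g *\<^sub>R y)"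
proof -
  define T where "T = blinfun_scaleR_left y o\<^sub>L \<phi>"
  have T: "T x = \<phi> x *\<^sub>R y" for x by (simp add: T_def)
  then have "rank_one T" by (auto simp: rank_one_def)
  then have "norm (id_blinfun + T) = 1 + norm T"
    using D by (simp add: daugavet_property_def)
  moreover have "norm T \<ge> 1"
  proof (rule ccontr)
    assume "\<not> norm T \<ge> 1"
    moreover have "norm \<phi> \<le> norm T"
      by (rule norm_blinfun_bound) (use norm_blinfun[of T] y in \<open>auto simp: T\<close>)
    ultimately show False using \<phi> by simp
  qed
  ultimately obtain g where g: "norm g \<le> 1" "2 - e < norm (g + \<phi> g *\<^sub>R y)"
    using norm_blinfun_gt[of "2 - e" "id_blinfun + T"] e by (auto simp: blinfun.add_left T)
  show ?thesis
  proof (cases "0 \<le> \<phi> g")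
    case True
    then show ?thesis using that[of g] g by simp
  next
    case False
    then show ?thesis
      using that[of "- g"] g norm_minus_cancel[of "g + \<phi> g *\<^sub>R y"]
      by (simp add: blinfun.minus_right)
  qed
qed

lemma daugavet_property_nontrivial:
  assumes "daugavet_property TYPE('x::banach)"
  obtains x :: "'x::banach" where "norm x = 1"
proof -
  have "rank_one (0 :: 'x \<Rightarrow>\<^sub>L 'x)"
    by (auto simp: rank_one_def intro!: exI[of _ 0])
  then have "norm (id_blinfun :: 'x \<Rightarrow>\<^sub>L 'x) = 1"
    using assms by (auto simp: daugavet_property_def)
  then have "0 < norm (id_blinfun :: 'x \<Rightarrow>\<^sub>L 'x)" by simp
  from norm_blinfun_gt[OF this order_refl] obtain x :: 'x where "0 < norm (id_blinfun x)" .
  then have "norm (x /\<^sub>R norm x) = 1" by simp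
  then show ?thesis by (rule that)
qed

text \<open>
  The Daugavet property gives a function \<open>g\<close> in the unit ball that almost climbs with slope \<open>1\<close> from
  \<open>a\<close> to \<open>b\<close>, and a pair \<open>(u, v)\<close> where \<open>g\<close>, \<open>w\<close> and the segment function all descend from \<open>u\<close> to \<open>v\<close>
  almost as steeply as possible. Then \<open>d(a, b) + d(u, v)\<close> is about
  \<open>(g b - g a) + (g u - g v) \<le> d(u, a) + d(v, b)\<close> because of \<open>g\<close>, and this is at most about \<open>d(a, b)\<close> because of
  the segment function. So \<open>u\<close> and \<open>v\<close> are close together in comparison to \<open>d(a, b)\<close>. The steepness of
  \<open>w\<close> decreases by an arbitrarily small amount only; hence the strict bound \<open>1 - \<eta>\<close> survives and
  the step can be iterated.
\<close>

lemma daugavet_halve_pair: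
  fixes w :: "'m::{metric_space,zero} lip0"
  assumes D: "daugavet_property TYPE('m lip0)" and w: "norm w \<le> 1"
    and \<eta>: "\<eta> \<le> 1 / 8" and ab: "a \<noteq> b" "1 - \<eta> < slope a b w"
  obtains u v where "u \<noteq> v" "1 - \<eta> < slope u v w" "dist u v \<le> dist a b / 2"
proof -
  define F where "F t = dist a b * dist t b / (dist t a + dist t b)" for t
  define f where "f = lip0_of F"
  note F_def' = F_def[abs_def]
  have FL: "1-lipschitz_on UNIV F"
    unfolding F_def' using ab(1) by (rule segment_function_lipschitz)
  have f_apply: "lip0_apply f t = F t - F 0" for t
    unfolding f_def using FL by (rule lip0_apply_lip0_of)
  have f: "norm f \<le> 1"
    unfolding f_def using FL by (rule norm_lip0_of_le)
  have F_ends: "F a = dist a b" "F b = 0"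
    using segment_function_ends[OF ab(1)] by (simp_all add: F_def)
  have f_ab: "slope a b f = 1" "slope b a f = - 1"
    using ab(1) by (simp_all add: slope_apply f_apply F_ends dist_commute)
  define s where "s = slope a b w"
  define N where "N = norm (w + f)"
  have N: "s + 1 \<le> N" "N \<le> 2"
    using slope_le_norm[of a b "w + f"] norm_triangle_ineq[of w f] w f
    by (simp_all add: N_def s_def blinfun.add_right f_ab)
  have N0: "N > 0" using N(1) ab(2) \<eta> by (simp add: s_def)
  define y where "y = (w + f) /\<^sub>R N"
  have y: "norm y = 1"
    using N0 by (simp add: y_def N_def)
  have "1 \<le> norm (slope b a) * norm f"
    using norm_blinfun[of "slope b a" f] f_ab(2) by simp
  also have "\<dots> \<le> norm (slope b a) * 1"
    using f by (intro mult_left_mono) auto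
  finally have \<phi>: "norm (slope b a) = 1"
    using norm_slope_le[of b a] by simp
  define e where "e = min (1 / 16) ((s - (1 - \<eta>)) / 4)"
  have e: "0 < e" "e \<le> 1 / 16" "e \<le> (s - (1 - \<eta>)) / 4"
  proof -
    show "0 < e" using ab(2) by (simp add: e_def s_def)
  qed (simp_all only: e_def min.cobounded1 min.cobounded2)
  have e_small: "2 * e < s - (1 - \<eta>)"
    using e(1,3) by argo
  have "e \<le> 1" using e(2) by simp
  from daugavet_property_slice[OF D \<phi> y e(1) this] obtain g where
    g: "norm g \<le> 1" "0 \<le> slope b a g" "2 - e < norm (g + slope b a g *\<^sub>R y)" .
  obtain u v where uv: "u \<noteq> v" "2 - e < slope u v (g + slope b a g *\<^sub>R y)"
    using exists_slope_gt[OF g(3)] e by auto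
  have le1: "slope u v g \<le> 1" "slope b a g \<le> 1" "slope u v y \<le> 1" "slope u v w \<le> 1" "slope u v f \<le> 1"
    using slope_le_norm[of u v g] slope_le_norm[of b a g] slope_le_norm[of u v y]
      slope_le_norm[of u v w] slope_le_norm[of u v f] g(1) y w f by linarith+
  have sum: "2 - e < slope u v g + slope b a g * slope u v y"
    using uv(2) by (simp add: blinfun.add_right blinfun.scaleR_right)
  have p1: "slope b a g * slope u v y \<le> slope b a g"
    using mult_left_mono[OF le1(3) g(2)] by simp
  have y0: "slope u v y \<ge> 0"
  proof (rule ccontr)
    assume "\<not> ?thesis"
    then have "slope b a g * slope u v y \<le> 0"
      using g(2) by (simp add: mult_nonneg_nonpos)
    then show False using sum le1(1) e(2) by linarith
  qed
  have p2: "slope b a g * slope u v y \<le> slope u v y"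
    using mult_right_mono[OF le1(2) y0] by simp
  have g_uv: "1 - e < slope u v g" and g_ba: "1 - e < slope b a g" and y_uv: "1 - e < slope u v y"
    using sum p1 p2 le1 by linarith+
  have "N * slope u v y = slope u v w + slope u v f"
    using N0 by (simp add: y_def blinfun.scaleR_right blinfun.add_right)
  moreover have "N * (1 - e) \<le> N * slope u v y"
    using y_uv N0 by simp
  moreover have "N * e \<le> 2 * e"
    using N(2) e(1) by simp
  ultimately have "s + 1 - 2 * e \<le> slope u v w + slope u v f"
    using N(1) by (simp add: algebra_simps)
  then have w_uv: "s - 2 * e \<le> slope u v w" and f_uv: "7 / 8 \<le> slope u v f"
    using le1 e_small \<eta> by linarith+
  have "7 / 8 * dist u v \<le> F u - F v"
    using f_uv uv(1) by (simp add: slope_apply f_apply field_simps)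
  then have "7 / 8 * (dist u a + dist v b) \<le> dist a b"
    unfolding F_def' by (intro segment_function_steep ab(1) uv(1)) auto
  moreover have "15 / 16 * dist u v \<le> lip0_apply g u - lip0_apply g v"
  proof -
    have "15 / 16 \<le> slope u v g" using g_uv e(2) by linarith
    then show ?thesis using uv(1) by (simp add: slope_apply field_simps)
  qed
  moreover have "15 / 16 * dist a b \<le> lip0_apply g b - lip0_apply g a"
  proof -
    have "15 / 16 \<le> slope b a g" using g_ba e(2) by linarith
    then show ?thesis using ab(1) by (simp add: slope_apply field_simps dist_commute)
  qed
  moreover have "lip0_apply g u - lip0_apply g a \<le> dist u a" "lip0_apply g b - lip0_apply g v \<le> dist v b"
    using lip0_apply_diff_le[OF g(1), of u a] lip0_apply_diff_le[OF g(1), of b v]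
    by (simp_all add: dist_commute)
  \<comment> \<open>In fact \<open>15 / 16 (d(a, b) + d(u, v)) \<le> 8 / 7 d(a, b)\<close>.\<close>
  ultimately have "dist u v \<le> dist a b / 2"
    using zero_le_dist[of a b] by argo
  moreover have "1 - \<eta> < slope u v w"
    using w_uv e_small by linarith
  ultimately show ?thesis using that uv(1) by blast
qed

lemma daugavet_short_pair:
  fixes w :: "'m::{metric_space,zero} lip0"
  assumes D: "daugavet_property TYPE('m lip0)" and w: "norm w \<le> 1"
    and \<eta>: "\<eta> \<le> 1 / 8" and ab: "a \<noteq> b" "1 - \<eta> < slope a b w" and r: "r > 0"
  obtains u v where "u \<noteq> v" "1 - \<eta> < slope u v w" "dist u v < r"
proof -
  have step: "\<exists>u v. u \<noteq> v \<and> 1 - \<eta> < slope u v w \<and> dist u v \<le> dist a b / 2 ^ k" for k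
  proof (induction k)
    case 0
    show ?case using ab by auto
  next
    case (Suc k)
    then obtain u v where uv: "u \<noteq> v" "1 - \<eta> < slope u v w" "dist u v \<le> dist a b / 2 ^ k"
      by blast
    from daugavet_halve_pair[OF D w \<eta> uv(1,2)] obtain x y where
      "x \<noteq> y" "1 - \<eta> < slope x y w" "dist x y \<le> dist u v / 2" .
    moreover have "dist u v / 2 \<le> dist a b / 2 ^ Suc k"
      using uv(3) by simp
    ultimately show ?case by (meson order_trans)
  qed
  obtain k where "dist a b / r < 2 ^ k"
    using real_arch_pow[of 2 "dist a b / r"] by auto
  then have "dist a b / 2 ^ k < r"
    using r by (simp add: field_simps)
  with step[of k] that show ?thesis by (meson le_less_trans)
qed

text \<open>
  Compose \<open>w\<close> with monotone contractions of the line that collapse the interval of radius \<open>r i\<close>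
  around (the current value at) \<open>p i\<close> to a point. Increments do not grow, and the increment between
  any two points loses at most the total length of the collapsed intervals.
\<close>

lemma flatten_near_points:
  fixes w :: "'m::{metric_space,zero} lip0"
      and r :: "nat \<Rightarrow> real"
  assumes w: "norm w \<le> 1" and r: "\<And>i. 0 \<le> r i"
  obtains w' where "norm w' \<le> 1"
    "\<And>u v. 0 < slope u v w' \<Longrightarrow> slope u v w' \<le> slope u v w"
    "\<And>i u v. i < n \<Longrightarrow> u \<in> cball (p i) (r i) \<Longrightarrow> v \<in> cball (p i) (r i) \<Longrightarrow> slope u v w' = 0"
    "lip0_apply w a - lip0_apply w b - (\<Sum>i<n. 2 * r i) \<le> lip0_apply w' a - lip0_apply w' b"
proof -
  have "\<exists>w'. norm w' \<le> 1 \<and> (\<forall>u v. 0 < slope u v w' \<longrightarrow> slope u v w' \<le> slope u v w) \<and>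
      (\<forall>i<n. \<forall>u\<in>cball (p i) (r i). \<forall>v\<in>cball (p i) (r i). lip0_apply w' u = lip0_apply w' v) \<and>
      lip0_apply w a - lip0_apply w b - (\<Sum>i<n. 2 * r i) \<le> lip0_apply w' a - lip0_apply w' b" for n
  proof (induction n)
    case 0
    show ?case using w by auto
  next
    case (Suc n)
    then obtain w1 where w1: "norm w1 \<le> 1" "\<And>u v. 0 < slope u v w1 \<Longrightarrow> slope u v w1 \<le> slope u v w"
      "\<And>i u v. i < n \<Longrightarrow> u \<in> cball (p i) (r i) \<Longrightarrow> v \<in> cball (p i) (r i) \<Longrightarrow> lip0_apply w1 u = lip0_apply w1 v"
      "lip0_apply w a - lip0_apply w b - (\<Sum>i<n. 2 * r i) \<le> lip0_apply w1 a - lip0_apply w1 b"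
      by blast
    define \<sigma> where "\<sigma> s = s - max (- r n) (min (r n) s)" for s
    have \<sigma>: "\<sigma> s \<le> \<sigma> t" "\<sigma> t - \<sigma> s \<le> t - s" if "s \<le> t" for s t
      using that r[of n] by (auto simp: \<sigma>_def max_def min_def)
    have \<sigma>_ge: "t - s - 2 * r n \<le> \<sigma> t - \<sigma> s" for s t
      using r[of n] by (auto simp: \<sigma>_def max_def min_def)
    have \<sigma>_zero: "\<sigma> s = 0" if "\<bar>s\<bar> \<le> r n" for s
      using that by (auto simp: \<sigma>_def max_def min_def abs_le_iff)
    define F where "F t = \<sigma> (lip0_apply w1 t - lip0_apply w1 (p n))" for t
    have F_le: "F x - F y \<le> max 0 (lip0_apply w1 x - lip0_apply w1 y)" for x y
      using \<sigma>[of "lip0_apply w1 x - lip0_apply w1 (p n)" "lip0_apply w1 y - lip0_apply w1 (p n)"]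
        \<sigma>[of "lip0_apply w1 y - lip0_apply w1 (p n)" "lip0_apply w1 x - lip0_apply w1 (p n)"]
      unfolding F_def by linarith
    have F_diff: "F x - F y \<le> dist x y" for x y
      using F_le[of x y] lip0_apply_diff_le[OF w1(1), of x y] zero_le_dist[of x y] by linarith
    have FL: "1-lipschitz_on UNIV F"
    proof (rule lipschitz_onI)
      show "dist (F x) (F y) \<le> 1 * dist x y" for x y
        using F_diff[of x y] F_diff[of y x] by (simp add: dist_real_def abs_le_iff dist_commute)
    qed simp
    define w' where "w' = lip0_of F"
    have w'_apply: "lip0_apply w' t = F t - F 0" for t
      unfolding w'_def using FL by (rule lip0_apply_lip0_of)
    have "norm w' \<le> 1"
      unfolding w'_def using FL by (rule norm_lip0_of_le)
    moreover have "slope u v w' \<le> slope u v w" if pos: "0 < slope u v w'" for u v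
    proof -
      have "u \<noteq> v" "0 < F u - F v"
        using pos by (auto simp: slope_apply w'_apply zero_less_divide_iff)
      then have "F u - F v \<le> lip0_apply w1 u - lip0_apply w1 v" "0 < lip0_apply w1 u - lip0_apply w1 v"
        using F_le[of u v] by linarith+
      then have "slope u v w' \<le> slope u v w1" "0 < slope u v w1"
        using \<open>u \<noteq> v\<close> by (simp_all add: slope_apply w'_apply divide_right_mono)
      then show ?thesis using w1(2) by (meson order_trans)
    qed
    moreover have "lip0_apply w' u = lip0_apply w' v"
      if "i < Suc n" "u \<in> cball (p i) (r i)" "v \<in> cball (p i) (r i)" for i u v
    proof (cases "i = n")
      case True
      have "F t = 0" if "t \<in> cball (p n) (r n)" for t
        unfolding F_def using that lip0_apply_diff_le[OF w1(1), of t "p n"]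
          lip0_apply_diff_le[OF w1(1), of "p n" t]
        by (intro \<sigma>_zero) (auto simp: abs_le_iff dist_commute)
      then show ?thesis using that True by (simp add: w'_apply)
    next
      case False
      then show ?thesis using w1(3)[of i u v] that by (simp add: w'_apply F_def)
    qed
    moreover have "lip0_apply w a - lip0_apply w b - (\<Sum>i<Suc n. 2 * r i) \<le> lip0_apply w' a - lip0_apply w' b"
      using w1(4) \<sigma>_ge[of "lip0_apply w1 a - lip0_apply w1 (p n)" "lip0_apply w1 b - lip0_apply w1 (p n)"]
      by (simp add: w'_apply F_def)
    ultimately show ?case by blast
  qed
  from this[of n] obtain w' where w': "norm w' \<le> 1"
    "\<forall>u v. 0 < slope u v w' \<longrightarrow> slope u v w' \<le> slope u v w"
    "\<forall>i<n. \<forall>u\<in>cball (p i) (r i). \<forall>v\<in>cball (p i) (r i). lip0_apply w' u = lip0_apply w' v"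
    "lip0_apply w a - lip0_apply w b - (\<Sum>i<n. 2 * r i) \<le> lip0_apply w' a - lip0_apply w' b"
    by (elim exE conjE)
  show ?thesis
  proof (rule that[of w'])
    show "slope u v w' \<le> slope u v w" if "0 < slope u v w'" for u v
      using w'(2) that by blast
    show "slope u v w' = 0" if "i < n" "u \<in> cball (p i) (r i)" "v \<in> cball (p i) (r i)" for i u v
    proof -
      have "lip0_apply w' u = lip0_apply w' v" using w'(3) that by blast
      then show ?thesis by (simp add: slope_apply)
    qed
  qed (rule w')+
qed

text \<open>
  All pairs are found from one pair \<open>(a, b)\<close>. The radii \<open>r i\<close> are fixed in advance so small that
  flattening around all former points leaves the slope between \<open>a\<close> and \<open>b\<close> above \<open>1 - \<eta>\<close>. A short
  steep pair of the flattened function cannot lie inside one of the flattened balls, and it is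
  at least as steep for \<open>w\<close>. The factor \<open>K\<close> is achieved by making the \<open>n\<close>-th pair shorter than
  \<open>r n / (4 K)\<close>.
\<close>

lemma daugavet_separated_pairs:
  fixes w :: "'m::{metric_space,zero} lip0"
  assumes D: "daugavet_property TYPE('m lip0)" and w: "norm w = 1"
    and \<eta>: "0 < \<eta>" "\<eta> \<le> 1 / 8" and K: "K \<ge> 1"
  obtains u v :: "nat \<Rightarrow> 'm" where "\<And>n. u n \<noteq> v n" "\<And>n. 1 - \<eta> < slope (u n) (v n) w"
    "\<And>i j. i \<noteq> j \<Longrightarrow> K * (dist (u i) (v i) + dist (u j) (v j)) \<le> dist (u i) (u j)"
proof -
  obtain a b where ab: "a \<noteq> b" "1 - \<eta> < slope a b w"
    using exists_slope_gt[of "1 - \<eta>" w] w \<eta> by auto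
  define s where "s = (slope a b w - (1 - \<eta>)) * dist a b"
  have s: "s > 0" using ab by (simp add: s_def)
  define r where "r i = s / 8 * (1 / 2) ^ i" for i :: nat
  have r: "r i > 0" for i using s by (simp add: r_def)
  have r_mono: "r j \<le> r i" if "i \<le> j" for i j
    unfolding r_def using s that by (intro mult_left_mono power_decreasing) auto
  have r_sum: "(\<Sum>i<n. 2 * r i) < s" for n
  proof -
    have "(\<Sum>i<n. 2 * r i) = s / 2 - s / 2 * (1 / 2) ^ n"
      by (induction n) (simp_all add: r_def algebra_simps)
    moreover have "0 < s / 2 * (1 / 2) ^ n" using s by simp
    ultimately show ?thesis using s by linarith
  qed
  define good where "good p n q \<longleftrightarrow> fst q \<noteq> snd q \<and> 1 - \<eta> < slope (fst q) (snd q) w \<and>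
      dist (fst q) (snd q) < r n / (4 * K) \<and>
      (\<forall>i<n. \<not> (fst q \<in> cball (fst (p i)) (r i) \<and> snd q \<in> cball (fst (p i)) (r i)))"
    for p :: "nat \<Rightarrow> 'm \<times> 'm" and n q
  have "\<exists>p. \<forall>n. good p n (p n)"
  proof (rule dependent_wellorder_choice)
    show "good f n q = good g n q" if "\<And>i. i < n \<Longrightarrow> f i = g i" for q f g and n :: nat
      using that by (simp add: good_def)
  next
    fix n and p :: "nat \<Rightarrow> 'm \<times> 'm"
    from flatten_near_points[of w r n "\<lambda>i. fst (p i)" a b] w r
    obtain w' where w': "norm w' \<le> 1"
      "\<And>u v. 0 < slope u v w' \<Longrightarrow> slope u v w' \<le> slope u v w"
      "\<And>i u v. i < n \<Longrightarrow> u \<in> cball (fst (p i)) (r i) \<Longrightarrow> v \<in> cball (fst (p i)) (r i) \<Longrightarrow> slope u v w' = 0"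
      "lip0_apply w a - lip0_apply w b - (\<Sum>i<n. 2 * r i) \<le> lip0_apply w' a - lip0_apply w' b"
      by (metis less_imp_le order_refl)
    have "s = lip0_apply w a - lip0_apply w b - (1 - \<eta>) * dist a b"
      using ab(1) by (simp add: s_def slope_apply field_simps)
    then have "(1 - \<eta>) * dist a b < lip0_apply w' a - lip0_apply w' b"
      using w'(4) r_sum[of n] by linarith
    then have "1 - \<eta> < slope a b w'"
      using ab(1) by (simp add: slope_apply field_simps)
    moreover have "r n / (4 * K) > 0" using r K by simp
    ultimately obtain u v where uv: "u \<noteq> v" "1 - \<eta> < slope u v w'" "dist u v < r n / (4 * K)"
      using daugavet_short_pair[OF D w'(1) \<eta>(2) ab(1)] by metis
    have "0 < slope u v w'" using uv(2) \<eta>(2) by linarith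
    then have "good p n (u, v)"
      using uv w'(2)[of u v] w'(3)[of _ u v] by (auto simp: good_def)
    then show "\<exists>q. good p n q" by blast
  qed
  then obtain p where p: "\<And>n. good p n (p n)" by blast
  define u v where "u n = fst (p n)" and "v n = snd (p n)" for n
  have uv: "u n \<noteq> v n" "1 - \<eta> < slope (u n) (v n) w" "dist (u n) (v n) < r n / (4 * K)"
    "i < n \<Longrightarrow> r i < dist (u i) (u n) \<or> r i < dist (u i) (v n)" for i n
    using p[of n] by (auto simp: good_def u_def v_def)
  have short: "K * dist (u n) (v n) < r n / 4" for n
    using uv(3)[of n] K by (simp add: field_simps)
  have sep: "K * (dist (u i) (v i) + dist (u n) (v n)) \<le> dist (u i) (u n)" if "i < n" for i n
  proof -
    have "1 * dist (u n) (v n) \<le> K * dist (u n) (v n)"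
      using K by (intro mult_right_mono) auto
    then have "r i - r n / 4 < dist (u i) (u n)"
      using uv(4)[OF that] dist_triangle[of "u i" "v n" "u n"] short[of n] r[of n] by linarith
    then show ?thesis
      using short[of i] short[of n] r_mono[of i n] r[of i] that by (simp add: distrib_left)
  qed
  have "K * (dist (u i) (v i) + dist (u j) (v j)) \<le> dist (u i) (u j)" if "i \<noteq> j" for i j
    using that sep[of i j] sep[of j i] by (cases i j rule: linorder_cases) (simp_all add: dist_commute add.commute)
  from that[OF uv(1,2) this] show ?thesis .
qed

section \<open>Disjoint bumps\<close>

text \<open>
  The bump at \<open>(u, v)\<close> raises \<open>f\<close> to the cone \<open>t \<mapsto> f v + d(u, v) - d(t, u)\<close>, which has slope \<open>1\<close> between
  \<open>u\<close> and \<open>v\<close> and agrees with \<open>f\<close> at \<open>v\<close>. Since \<open>f\<close> has a Lipschitz constant \<open>L < 1\<close>, it lies above the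
  cone outside the ball around \<open>u\<close> of radius \<open>2 d(u, v) / (1 - L)\<close>. These balls are disjoint, so
  adding bumps means taking the maximum of \<open>f\<close> and of cones, all of which are \<open>1\<close>-Lipschitz.
\<close>

lemma add_bumps:
  fixes f :: "'m::{metric_space,zero} lip0" and u v :: "nat \<Rightarrow> 'm"
  assumes f: "norm f < 1" and uv: "\<And>n. u n \<noteq> v n"
    and sep: "\<And>i j. i \<noteq> j \<Longrightarrow>
      2 / (1 - norm f) * (dist (u i) (v i) + dist (u j) (v j)) \<le> dist (u i) (u j)"
  obtains h :: "nat \<Rightarrow> 'm lip0" where
    "\<And>S. finite S \<Longrightarrow> norm (f + (\<Sum>i\<in>S. h i)) \<le> 1"
    "\<And>S n. finite S \<Longrightarrow> n \<in> S \<Longrightarrow> slope (u n) (v n) (f + (\<Sum>i\<in>S. h i)) = 1"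
proof -
  define L K where "L = norm f" and "K = 2 / (1 - L)"
  have K: "K \<ge> 2" using f by (simp add: K_def L_def le_divide_eq)
  define F d where "F = lip0_apply f" and "d n = dist (u n) (v n)" for n
  \<comment> \<open>The cone, and below the bump that raises \<open>F\<close> to it.\<close>
  define A where "A n t = F (v n) + d n - dist t (u n)" for n t
  define H where "H n t = max 0 (A n t - F t)" for n t
  have FL: "L-lipschitz_on UNIV F"
    unfolding F_def L_def by (rule lip0_apply_lipschitz_on)
  have F_diff: "F x - F y \<le> L * dist x y" for x y
    using lipschitz_onD[OF FL, of x y] by (simp add: dist_real_def)
  have L1: "L * dist x y \<le> dist x y" for x y :: 'm
    using f by (simp add: L_def mult_left_le_one_le)
  have A_diff: "A n x - A n y \<le> dist x y" for n x y
    using dist_triangle[of y "u n" x] by (simp add: A_def dist_commute)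
  have H_nonneg: "0 \<le> H n t" for n t by (simp add: H_def)
  have support: "dist t (u n) < K * d n" if "0 < H n t" for n t
  proof -
    have "F (v n) - F t \<le> L * (dist t (u n) + d n)"
      using F_diff[of "v n" t] dist_triangle[of "v n" t "u n"]
        mult_left_mono[of "dist (v n) t" "dist t (u n) + d n" L]
      by (simp add: d_def L_def dist_commute)
    moreover have "F t < A n t" using that by (simp add: H_def)
    ultimately have "(1 - L) * dist t (u n) < (1 + L) * d n"
      by (simp add: A_def algebra_simps)
    also have "\<dots> \<le> 2 * d n"
      using f by (intro mult_right_mono) (auto simp: L_def d_def)
    finally show ?thesis
      using f by (simp add: K_def L_def field_simps)
  qed
  have disjoint: "i = j" if "0 < H i t" "0 < H j t" for i j t
  proof (rule ccontr)
    assume "i \<noteq> j"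
    then have "K * (d i + d j) \<le> dist (u i) (u j)"
      using sep by (simp add: K_def L_def d_def)
    then show False
      using support[OF that(1)] support[OF that(2)] dist_triangle[of "u i" "u j" t]
      by (simp add: distrib_left dist_commute)
  qed
  have "(1 + L)-lipschitz_on UNIV (H n)" for n
  proof (rule lipschitz_onI)
    show "dist (H n x) (H n y) \<le> (1 + L) * dist x y" for x y
      using A_diff[of n x y] A_diff[of n y x] F_diff[of x y] F_diff[of y x]
      by (auto simp: H_def dist_real_def distrib_right dist_commute abs_le_iff max_def)
  qed (simp add: L_def)
  then have h_apply: "lip0_apply (lip0_of (H n)) t = H n t - H n 0" for n t
    by (rule lip0_apply_lip0_of)
  define G where "G S t = F t + (\<Sum>i\<in>S. H i t)" for S t
  have apply_sum: "lip0_apply (\<Sum>i\<in>S. h i) t = (\<Sum>i\<in>S. lip0_apply (h i) t)"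
    if "finite S" for S t and h :: "nat \<Rightarrow> 'm lip0"
    using that by (induction S) (simp_all add: zero_lip0.rep_eq plus_lip0.rep_eq)
  have g_apply: "lip0_apply (f + (\<Sum>i\<in>S. lip0_of (H i))) t = G S t - (\<Sum>i\<in>S. H i 0)"
    if "finite S" for S t
    using that by (simp add: plus_lip0.rep_eq apply_sum h_apply sum_subtractf G_def F_def)
  have G_ge: "F t \<le> G S t" for S t
    by (simp add: G_def sum_nonneg H_nonneg)
  have G_ge_A: "A i t \<le> G S t" if "finite S" "i \<in> S" for S i t
    using member_le_sum[of i S "\<lambda>i. H i t"] that H_nonneg by (simp add: G_def) (simp add: H_def)
  have G_eq: "G S t = A i t" if "finite S" "i \<in> S" "0 < H i t" for S i t
  proof -
    have "H j t = 0" if "j \<in> S - {i}" for j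
      using disjoint[of i t j] that H_nonneg[of j t] \<open>0 < H i t\<close> by force
    then have "(\<Sum>j\<in>S. H j t) = H i t"
      using that(1,2) by (simp add: sum.remove[of S i])
    then show ?thesis using that(3) by (simp add: G_def H_def)
  qed
  have G_diff: "G S x - G S y \<le> dist x y" if "finite S" for S x y
  proof (cases "\<exists>i\<in>S. 0 < H i x")
    case True
    then obtain i where i: "i \<in> S" "0 < H i x" by blast
    show ?thesis
      using G_eq[OF that i] G_ge_A[OF that i(1), of y] A_diff[of i x y] by simp
  next
    case False
    then have "G S x = F x"
      using H_nonneg by (simp add: G_def) (metis antisym not_less sum.neutral)
    then show ?thesis using G_ge[of y S] F_diff[of x y] L1[of x y] by simp
  qed
  have norm: "norm (f + (\<Sum>i\<in>S. lip0_of (H i))) \<le> 1" if "finite S" for S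
    unfolding norm_lip0.rep_eq
  proof (intro lipschitz_const_le lipschitz_onI)
    show "dist (lip0_apply (f + (\<Sum>i\<in>S. lip0_of (H i))) x) (lip0_apply (f + (\<Sum>i\<in>S. lip0_of (H i))) y)
        \<le> 1 * dist x y" for x y
      using G_diff[OF that, of x y] G_diff[OF that, of y x]
      by (simp add: g_apply[OF that] dist_real_def abs_le_iff dist_commute)
  qed simp
  have slope: "slope (u n) (v n) (f + (\<Sum>i\<in>S. lip0_of (H i))) = 1" if S: "finite S" "n \<in> S" for S n
  proof -
    have d: "d n > 0" using uv[of n] by (simp add: d_def)
    have "L * d n < 1 * d n"
      using f d by (intro mult_strict_right_mono) (auto simp: L_def)
    then have "0 < H n (u n)"
      using F_diff[of "u n" "v n"] by (simp add: H_def A_def d_def)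
    then have "G S (u n) = F (v n) + d n"
      using G_eq[OF S] by (simp add: A_def)
    moreover have "H i (v n) = 0" for i
    proof (rule ccontr)
      assume "H i (v n) \<noteq> 0"
      then have pos: "0 < H i (v n)" using H_nonneg[of i "v n"] by simp
      moreover have "H n (v n) = 0" by (simp add: H_def A_def d_def dist_commute)
      ultimately have "i \<noteq> n" by auto
      then have "K * (d i + d n) \<le> dist (u i) (u n)"
        using sep by (simp add: K_def L_def d_def)
      moreover have "1 * d n \<le> K * d n"
        using K d by (intro mult_right_mono) auto
      ultimately show False
        using support[OF pos] dist_triangle[of "u i" "u n" "v n"]
        by (simp add: d_def distrib_left dist_commute)
    qed
    then have "G S (v n) = F (v n)" by (simp add: G_def)
    ultimately show ?thesis
      using uv[of n] by (simp add: slope_apply g_apply[OF S(1)] d_def)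
  qed
  from that[OF norm slope] show ?thesis .
qed

section \<open>The polynomial Daugavet property\<close>

theorem proposition4p4:
  assumes "daugavet_property TYPE('m::{complete_space,zero} lip0)"
  shows "polynomial_daugavet_property TYPE('m lip0)"
  unfolding polynomial_daugavet_property_def
proof (intro allI impI)
  fix P :: "'m lip0 \<Rightarrow> 'm lip0"
  assume P: "continuous_polynomial P" "weakly_compact_map P"
  let ?N = "polynomial_norm P" and ?N' = "polynomial_norm (\<lambda>x. x + P x)"
  have sum_le: "norm (x + P x) \<le> 1 + ?N" if "norm x \<le> 1" for x
    using norm_triangle_ineq[of x "P x"] norm_le_polynomial_norm[OF P(1) that] that by linarith
  have le: "?N' \<le> 1 + ?N"
    unfolding polynomial_norm_def[of "\<lambda>x. x + P x"] using sum_le by (intro cSUP_least) auto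
  have lower: "norm (x + P x) \<le> ?N'" if "norm x \<le> 1" for x
    unfolding polynomial_norm_def using that sum_le
    by (intro cSUP_upper bdd_aboveI[of _ "1 + ?N"]) auto
  have N0: "0 \<le> ?N"
    using norm_ge_zero[of "P 0"] norm_le_polynomial_norm[OF P(1), of 0] by (rule order_trans) simp
  have "1 + ?N \<le> ?N'"
  proof (rule field_le_epsilon)
    fix e :: real assume e: "0 < e"
    obtain f where f: "norm f < 1" "?N - e / 3 < norm (P f)"
      using polynomial_norm_approximated_inside[OF P(1), of "?N - e / 3"] e by auto
    obtain w where w: "norm w = 1" "P f = norm (P f) *\<^sub>R w"
    proof (cases "P f = 0")
      case True
      obtain w :: "'m lip0" where "norm w = 1"
        using daugavet_property_nontrivial[OF assms] .
      with True show ?thesis using that by simp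
    next
      case False
      then show ?thesis using that[of "P f /\<^sub>R norm (P f)"] by simp
    qed
    define \<eta> where "\<eta> = min (1 / 8) (e / 3 / (1 + ?N))"
    have \<eta>: "0 < \<eta>" "\<eta> \<le> 1 / 8"
      using e N0 by (simp_all only: \<eta>_def min.cobounded1) simp
    have "norm (P f) * \<eta> \<le> (1 + ?N) * (e / 3 / (1 + ?N))"
      using norm_le_polynomial_norm[OF P(1), of f] f(1) N0 \<eta>(1)
      by (intro mult_mono) (auto simp: \<eta>_def)
    also have "\<dots> = e / 3"
    proof -
      have "1 + ?N \<noteq> 0" using N0 by linarith
      then show ?thesis by (metis nonzero_mult_div_cancel_left times_divide_eq_right)
    qed
    finally have loss: "norm (P f) * \<eta> \<le> e / 3" .
    have K: "2 / (1 - norm f) \<ge> 1"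
      using f(1) norm_ge_zero[of f] by (simp add: le_divide_eq del: norm_ge_zero)
    show "1 + ?N \<le> ?N' + e"
    proof (rule daugavet_separated_pairs[OF assms w(1) \<eta> K])
      fix u v :: "nat \<Rightarrow> 'm"
      assume uv: "\<And>n. u n \<noteq> v n" "\<And>n. 1 - \<eta> < slope (u n) (v n) w"
        "\<And>i j. i \<noteq> j \<Longrightarrow>
          2 / (1 - norm f) * (dist (u i) (v i) + dist (u j) (v j)) \<le> dist (u i) (u j)"
      have slope_Pf: "norm (P f) * (1 - \<eta>) \<le> slope (u n) (v n) (P f)" for n
      proof -
        have "slope (u n) (v n) (P f) = norm (P f) * slope (u n) (v n) w"
          by (subst w(2)) (simp add: blinfun.scaleR_right)
        then show ?thesis using uv(2)[of n] by (simp add: mult_left_mono)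
      qed
      show ?thesis
      proof (rule add_bumps[OF f(1) uv(1,3)])
        fix h :: "nat \<Rightarrow> 'm lip0"
        assume h: "\<And>S. finite S \<Longrightarrow> norm (f + (\<Sum>i\<in>S. h i)) \<le> 1"
          "\<And>S n. finite S \<Longrightarrow> n \<in> S \<Longrightarrow> slope (u n) (v n) (f + (\<Sum>i\<in>S. h i)) = 1"
        have "e / 3 > 0" using e by simp
        from weakly_compact_polynomial_diagonal[of P f h "\<lambda>n. slope (u n) (v n)",
            OF P h(1) norm_slope_le slope_Pf this]
        obtain S n where S: "finite S" "n \<in> S"
          "norm (P f) * (1 - \<eta>) - e / 3 \<le> slope (u n) (v n) (P (f + (\<Sum>i\<in>S. h i)))" .
        define g where "g = f + (\<Sum>i\<in>S. h i)"
        have "1 + (norm (P f) * (1 - \<eta>) - e / 3) \<le> slope (u n) (v n) (g + P g)"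
          using S(3) h(2)[OF S(1,2)] by (simp add: g_def blinfun.add_right)
        also have "\<dots> \<le> norm (g + P g)"
          by (rule slope_le_norm)
        also have "\<dots> \<le> ?N'"
          using h(1)[OF S(1)] by (intro lower) (simp add: g_def)
        finally show ?thesis
          using f(2) loss by (simp add: right_diff_distrib)
      qed
    qed
  qed
  with le show "?N' = 1 + ?N" by simp
qed

end
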